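(* Let $X$ be a pointed topological space, let $Y$ be a homotopy commutative $H$-group and let $f:X\to Y$ be a map. Let $m=o(f)$ if $f$ has finite order, and $m=0$ otherwise. Let $r\geq 2$, suppose $g=\sum_{i=1}^r k_if_i\in\langle f_1,\dots,f_r\rangle\leq [X,Y^r]$ with $k_1,\dots,k_r\in\mathbb Z$, and let $k=\gcd(m,k_1,\dots,k_r)$. Then there is a homotopy decomposition $$F^g\simeq F^{\mathbf kf}\times\prod_{i=1}^{r-1}\Omega Y.$$ In particular, if the order of $f$ is finite and the maps $g,g'\in\langle f_1,\dots,f_r\rangle$ have the same order, then $F^g\simeq F^{g'}$.
   Context: All spaces have the homotopy type of CW-complexes with non-degenerate basepoints and maps are pointed. An $H$-group is a homotopy associative $H$-space with a homotopy inverse. The sets $[X,Y]$ and $[X,Y^r]$ are groups under the operations induced by the multiplication of $Y$ (coordinatewise on $Y^r$), abelian because $Y$ is homotopy commutative; orders $o(\cdot)$ are taken in these groups and a map is denoted by the same letter as its homotopy class. For $1\le i\le r$, $f_i:X\to Y^r=\prod_{j=1}^rY$ is the map with $p_j\circ f_i=f$ if $j=i$ and $p_j\circ f_i$ constant if $j\neq i$, where $p_j$ is the projection onto the $j$-th factor; $\langle f_1,\dots,f_r\rangle$ is the subgroup they generate. For $k\in\mathbb Z$, $\mathbf k:Y\to Y$ is the $k$-th power map, $\mathbf kf$ is the composite $X\xrightarrow{f}Y\xrightarrow{\mathbf k}Y$, and $F^{\mathbf kf}$ is its homotopy fibre. $F^g$ denotes the homotopy fibre of $g:X\to Y^r$.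 *)

theory Defs
  imports "HOL-Analysis.Analysis" "HOL-Algebra.Multiplicative_Group" "HOL-Algebra.Generated_Groups"
begin

section \<open>Pointed spaces, pointed maps, pointed homotopy\<close>

definition pointed_map :: "'a topology \<Rightarrow> 'a \<Rightarrow> 'b topology \<Rightarrow> 'b \<Rightarrow> ('a \<Rightarrow> 'b) \<Rightarrow> bool" where
  "pointed_map X x0 Y y0 f \<longleftrightarrow> continuous_map X Y f \<and> f x0 = y0"

definition pointed_homotopic ::
    "'a topology \<Rightarrow> 'a \<Rightarrow> 'b topology \<Rightarrow> 'b \<Rightarrow> ('a \<Rightarrow> 'b) \<Rightarrow> ('a \<Rightarrow> 'b) \<Rightarrow> bool" where
  "pointed_homotopic X x0 Y y0 f g \<longleftrightarrow> homotopic_with (\<lambda>h. h x0 = y0) X Y f g"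

definition pointed_homotopy_equivalent ::
    "'a topology \<Rightarrow> 'a \<Rightarrow> 'b topology \<Rightarrow> 'b \<Rightarrow> bool" where
  "pointed_homotopy_equivalent X x0 Y y0 \<longleftrightarrow>
     (\<exists>u v. pointed_map X x0 Y y0 u \<and> pointed_map Y y0 X x0 v \<and>
            pointed_homotopic X x0 X x0 (v \<circ> u) id \<and>
            pointed_homotopic Y y0 Y y0 (u \<circ> v) id)"

text \<open>The basepoint is non-degenerate when \<open>(X, {x0})\<close> is an NDR pair
  (equivalently, when the inclusion of \<open>x0\<close> is a closed cofibration).\<close>

definition nondegenerate_basepoint :: "'a topology \<Rightarrow> 'a \<Rightarrow> bool" where
  "nondegenerate_basepoint X x0 \<longleftrightarrow> x0 \<in> topspace X \<and>
     (\<exists>u h. continuous_map X (top_of_set {0..1::real}) u \<and>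
            (\<forall>x\<in>topspace X. u x = 0 \<longleftrightarrow> x = x0) \<and>
            continuous_map (prod_topology (top_of_set {0..1::real}) X) X h \<and>
            (\<forall>x\<in>topspace X. h (0, x) = x) \<and>
            (\<forall>t\<in>{0..1}. h (t, x0) = x0) \<and>
            (\<forall>x\<in>topspace X. u x < 1 \<longrightarrow> h (1, x) = x0))"

section \<open>CW-complexes\<close>

definition cell_disc :: "nat \<Rightarrow> (nat \<Rightarrow> real) set" where
  "cell_disc n = {x \<in> topspace (Euclidean_space n). (\<Sum>i<n. (x i)\<^sup>2) \<le> 1}"

definition cell_interior :: "nat \<Rightarrow> (nat \<Rightarrow> real) set" where
  "cell_interior n = {x \<in> topspace (Euclidean_space n). (\<Sum>i<n. (x i)\<^sup>2) < 1}"

definition cell_sphere :: "nat \<Rightarrow> (nat \<Rightarrow> real) set" where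
  "cell_sphere n = {x \<in> topspace (Euclidean_space n). (\<Sum>i<n. (x i)\<^sup>2) = 1}"

text \<open>\<open>E n\<close> is the set of open \<open>n\<close>-cells, as subsets of \<open>Z\<close>, and \<open>\<Phi> n e\<close> is the
  characteristic map of the cell \<open>e \<in> E n\<close>. Its image on the closed disc is the closure
  of \<open>e\<close>. The last two conjuncts are closure-finiteness and the weak topology.\<close>

definition CW_complex :: "'a topology \<Rightarrow> bool" where
  "CW_complex Z \<longleftrightarrow> Hausdorff_space Z \<and>
     (\<exists>(E :: nat \<Rightarrow> 'a set set) (\<Phi> :: nat \<Rightarrow> 'a set \<Rightarrow> (nat \<Rightarrow> real) \<Rightarrow> 'a).
        (\<Union>n. \<Union>(E n)) = topspace Z \<and>
        (\<forall>m n. \<forall>d\<in>E m. \<forall>e\<in>E n. (m, d) \<noteq> (n, e) \<longrightarrow> d \<inter> e = {}) \<and>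
        (\<forall>n. \<forall>e\<in>E n.
           continuous_map (subtopology (Euclidean_space n) (cell_disc n)) Z (\<Phi> n e) \<and>
           homeomorphic_map (subtopology (Euclidean_space n) (cell_interior n))
                            (subtopology Z e) (\<Phi> n e)) \<and>
        (\<forall>n. \<forall>e\<in>E n. \<exists>D. finite D \<and> D \<subseteq> (\<Union>m\<in>{..<n}. E m) \<and>
           \<Phi> n e ` cell_sphere n \<subseteq> \<Union>D) \<and>
        (\<forall>C\<subseteq>topspace Z.
           closedin Z C \<longleftrightarrow> (\<forall>n. \<forall>e\<in>E n. closedin Z (C \<inter> \<Phi> n e ` cell_disc n))))"

section \<open>Path spaces, loop spaces and homotopy fibres\<close>

text \<open>Points of a mapping space are maps that are \<^const>\<open>undefined\<close> off \<open>topspace X\<close>,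
  so that each continuous map is represented exactly once.\<close>

definition compact_open_topology :: "'a topology \<Rightarrow> 'b topology \<Rightarrow> ('a \<Rightarrow> 'b) topology" where
  "compact_open_topology X Y =
     topology_generated_by
       {{f \<in> extensional (topspace X). continuous_map X Y f \<and> f ` K \<subseteq> U} | K U.
          compactin X K \<and> openin Y U}"

definition path_topology :: "'b topology \<Rightarrow> (real \<Rightarrow> 'b) topology" where
  "path_topology Y = compact_open_topology (top_of_set {0..1::real}) Y"

definition const_path :: "'b \<Rightarrow> real \<Rightarrow> 'b" where
  "const_path y = (\<lambda>t\<in>{0..1}. y)"

definition loop_topology :: "'b topology \<Rightarrow> 'b \<Rightarrow> (real \<Rightarrow> 'b) topology" where
  "loop_topology Y y0 = subtopology (path_topology Y) {\<gamma>. \<gamma> 0 = y0 \<and> \<gamma> 1 = y0}"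

definition homotopy_fibre ::
    "'a topology \<Rightarrow> 'b topology \<Rightarrow> 'b \<Rightarrow> ('a \<Rightarrow> 'b) \<Rightarrow> ('a \<times> (real \<Rightarrow> 'b)) topology" where
  "homotopy_fibre X Y y0 g =
     subtopology (prod_topology X (path_topology Y)) {(x, \<gamma>). \<gamma> 0 = y0 \<and> \<gamma> 1 = g x}"

section \<open>H-groups\<close>

definition H_space :: "'b topology \<Rightarrow> 'b \<Rightarrow> ('b \<times> 'b \<Rightarrow> 'b) \<Rightarrow> bool" where
  "H_space Y y0 mul \<longleftrightarrow> y0 \<in> topspace Y \<and>
     pointed_map (prod_topology Y Y) (y0, y0) Y y0 mul \<and>
     pointed_homotopic Y y0 Y y0 (\<lambda>y. mul (y, y0)) id \<and>
     pointed_homotopic Y y0 Y y0 (\<lambda>y. mul (y0, y)) id"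

definition H_group :: "'b topology \<Rightarrow> 'b \<Rightarrow> ('b \<times> 'b \<Rightarrow> 'b) \<Rightarrow> ('b \<Rightarrow> 'b) \<Rightarrow> bool" where
  "H_group Y y0 mul neg \<longleftrightarrow> H_space Y y0 mul \<and>
     pointed_homotopic (prod_topology (prod_topology Y Y) Y) ((y0, y0), y0) Y y0
       (\<lambda>((a, b), c). mul (mul (a, b), c)) (\<lambda>((a, b), c). mul (a, mul (b, c))) \<and>
     pointed_map Y y0 Y y0 neg \<and>
     pointed_homotopic Y y0 Y y0 (\<lambda>y. mul (y, neg y)) (\<lambda>y. y0) \<and>
     pointed_homotopic Y y0 Y y0 (\<lambda>y. mul (neg y, y)) (\<lambda>y. y0)"

definition homotopy_commutative :: "'b topology \<Rightarrow> 'b \<Rightarrow> ('b \<times> 'b \<Rightarrow> 'b) \<Rightarrow> bool" where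
  "homotopy_commutative Y y0 mul \<longleftrightarrow>
     pointed_homotopic (prod_topology Y Y) (y0, y0) Y y0 mul (\<lambda>(a, b). mul (b, a))"

text \<open>Power maps; powers are bracketed to the left and start from the basepoint. Other
  conventions give homotopic maps when \<open>Y\<close> is an H-group.\<close>

primrec nat_power_map :: "('b \<times> 'b \<Rightarrow> 'b) \<Rightarrow> 'b \<Rightarrow> nat \<Rightarrow> 'b \<Rightarrow> 'b" where
  "nat_power_map mul y0 0 y = y0"
| "nat_power_map mul y0 (Suc n) y = mul (nat_power_map mul y0 n y, y)"

definition power_map :: "('b \<times> 'b \<Rightarrow> 'b) \<Rightarrow> ('b \<Rightarrow> 'b) \<Rightarrow> 'b \<Rightarrow> int \<Rightarrow> 'b \<Rightarrow> 'b" where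
  "power_map mul neg y0 k y =
     (if k \<ge> 0 then nat_power_map mul y0 (nat k) y else neg (nat_power_map mul y0 (nat (- k)) y))"

section \<open>The groups \<open>[X, W]\<close>\<close>

definition htpy_class ::
    "'a topology \<Rightarrow> 'a \<Rightarrow> 'b topology \<Rightarrow> 'b \<Rightarrow> ('a \<Rightarrow> 'b) \<Rightarrow> ('a \<Rightarrow> 'b) set" where
  "htpy_class X x0 W w0 f = {h. pointed_homotopic X x0 W w0 f h}"

text \<open>The group is written multiplicatively, as always in HOL-Algebra. The product
  below is the class of \<open>mul \<circ> (a, b)\<close> for any representatives \<open>a\<close>, \<open>b\<close>.\<close>

definition htpy_group ::
    "'a topology \<Rightarrow> 'a \<Rightarrow> 'b topology \<Rightarrow> 'b \<Rightarrow> ('b \<times> 'b \<Rightarrow> 'b) \<Rightarrow> ('a \<Rightarrow> 'b) set monoid" where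
  "htpy_group X x0 W w0 mul =
     \<lparr>carrier = htpy_class X x0 W w0 ` {f. pointed_map X x0 W w0 f},
      monoid.mult = (\<lambda>A B. \<Union>a\<in>A. \<Union>b\<in>B. htpy_class X x0 W w0 (\<lambda>x. mul (a x, b x))),
      one = htpy_class X x0 W w0 (\<lambda>x. w0)\<rparr>"

section \<open>The power \<open>Y\<^sup>r\<close>\<close>

definition power_space :: "'b topology \<Rightarrow> nat \<Rightarrow> (nat \<Rightarrow> 'b) topology" where
  "power_space Y r = product_topology (\<lambda>_. Y) {1..r}"

definition power_pt :: "'b \<Rightarrow> nat \<Rightarrow> nat \<Rightarrow> 'b" where
  "power_pt y0 r = (\<lambda>j\<in>{1..r}. y0)"

definition power_mult ::
    "('b \<times> 'b \<Rightarrow> 'b) \<Rightarrow> nat \<Rightarrow> (nat \<Rightarrow> 'b) \<times> (nat \<Rightarrow> 'b) \<Rightarrow> nat \<Rightarrow> 'b" where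
  "power_mult mul r = (\<lambda>(a, b). \<lambda>j\<in>{1..r}. mul (a j, b j))"

definition coord_map :: "'b \<Rightarrow> nat \<Rightarrow> ('a \<Rightarrow> 'b) \<Rightarrow> nat \<Rightarrow> 'a \<Rightarrow> nat \<Rightarrow> 'b" where
  "coord_map y0 r f i = (\<lambda>x. \<lambda>j\<in>{1..r}. if j = i then f x else y0)"

abbreviation power_htpy_class ::
    "'a topology \<Rightarrow> 'a \<Rightarrow> 'b topology \<Rightarrow> 'b \<Rightarrow> nat \<Rightarrow> ('a \<Rightarrow> nat \<Rightarrow> 'b) \<Rightarrow> ('a \<Rightarrow> nat \<Rightarrow> 'b) set" where
  "power_htpy_class X x0 Y y0 r \<equiv> htpy_class X x0 (power_space Y r) (power_pt y0 r)"

abbreviation power_htpy_group ::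
    "'a topology \<Rightarrow> 'a \<Rightarrow> 'b topology \<Rightarrow> 'b \<Rightarrow> ('b \<times> 'b \<Rightarrow> 'b) \<Rightarrow> nat \<Rightarrow> ('a \<Rightarrow> nat \<Rightarrow> 'b) set monoid" where
  "power_htpy_group X x0 Y y0 mul r \<equiv>
     htpy_group X x0 (power_space Y r) (power_pt y0 r) (power_mult mul r)"

definition coord_subgroup ::
    "'a topology \<Rightarrow> 'a \<Rightarrow> 'b topology \<Rightarrow> 'b \<Rightarrow> ('b \<times> 'b \<Rightarrow> 'b) \<Rightarrow> nat \<Rightarrow> ('a \<Rightarrow> 'b) \<Rightarrow> ('a \<Rightarrow> nat \<Rightarrow> 'b) set set" where
  "coord_subgroup X x0 Y y0 mul r f =
     generate (power_htpy_group X x0 Y y0 mul r)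
       ((\<lambda>i. power_htpy_class X x0 Y y0 r (coord_map y0 r f i)) ` {1..r})"

text \<open>The order \<open>o(f)\<close>; since \<^const>\<open>group.ord\<close> is \<open>0\<close> on elements of infinite order,
  this is \<open>0\<close> exactly when \<open>f\<close> does not have finite order.\<close>

definition map_order ::
    "'a topology \<Rightarrow> 'a \<Rightarrow> 'b topology \<Rightarrow> 'b \<Rightarrow> ('b \<times> 'b \<Rightarrow> 'b) \<Rightarrow> ('a \<Rightarrow> 'b) \<Rightarrow> nat" where
  "map_order X x0 W w0 mul f = group.ord (htpy_group X x0 W w0 mul) (htpy_class X x0 W w0 f)"

end

theory Submission
  imports Defs
begin

text \<open>
  The pointed homotopy type of \<open>F\<^sup>g\<close> depends only on the homotopy class of \<open>g\<close>, and does not change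
  when \<open>g\<close> is composed with a pointed self homotopy equivalence of \<open>Y\<^sup>r\<close>. Adding one coordinate of
  \<open>Y\<^sup>r\<close> to another is such an equivalence, so Euclid's algorithm turns \<open>(k\<^sub>1 f, \<dots>, k\<^sub>r f)\<close> into
  \<open>(d f, 0, \<dots>, 0)\<close> with \<open>d = gcd(k\<^sub>1, \<dots>, k\<^sub>r)\<close>. As \<open>m f = 0\<close> and \<open>r \<ge> 2\<close>, the second entry may be replaced by
  \<open>m f\<close>, and one more run of the algorithm gives \<open>(k f, 0, \<dots>, 0)\<close>, whose fibre splits off \<open>r - 1\<close> loop
  spaces. For finite \<open>m\<close> the order of \<open>g\<close> is \<open>m / k\<close>, hence determines \<open>k\<close>.
\<close>

section \<open>Path spaces and homotopy fibres\<close>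

text \<open>The delicate point is composition with a self equivalence \<phi> that has homotopy
  inverse \<psi>. Post-composition takes the fibre of \<open>g\<close> to that of
  \<open>\<phi> \<circ> g\<close>, but returning with \<psi> ends in the fibre of
  \<open>\<psi> \<circ> \<phi> \<circ> g\<close>, so a transport along a homotopy from
  \<open>\<psi> \<circ> \<phi>\<close> to \<open>id\<close> has to follow. The homotopies for the
  two composites are unrelated, so the comparison maps are not visibly inverse to each other; a
  formal cancellation of one-sided inverses replaces a coherent choice. The explicit homotopies of
  fibres leave the point of \<open>X\<close> fixed and deform only the path, by moving a parameter
  in an interval or a square. Adding one coordinate to another is invertible up to homotopy because
  an H-group allows subtraction. No other self equivalences of the power are used: subtraction is
  addition reversed, and signs are corrected with the help of a zero entry. The reduction can
  therefore be done for an abstract relation on integer tuples.\<close>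

lemma topspace_path_topology:
  "topspace (path_topology Y) =
     {\<gamma> \<in> extensional {0..1}. continuous_map (top_of_set {0..1}) Y \<gamma>}"
proof -
  have "\<Union>{{f \<in> extensional {0..1}. continuous_map (top_of_set {0..1}) Y f \<and> f ` K \<subseteq> U} | K U.
          compactin (top_of_set {0..1::real}) K \<and> openin Y U} =
     {\<gamma> \<in> extensional {0..1}. continuous_map (top_of_set {0..1}) Y \<gamma>}" (is "\<Union>?S = ?T")
  proof
    \<comment> \<open>For \<open>K = {}\<close> the subbasic set imposes no condition beyond being a
      path, so it is already the whole space.\<close>
    have "?T \<in> ?S"
      by (rule CollectI, rule exI[of _ "{}"], rule exI[of _ "{}"]) auto
    then show "?T \<subseteq> \<Union>?S" by (rule Union_upper)
  qed auto
  then show ?thesis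
    unfolding path_topology_def compact_open_topology_def by simp
qed

text \<open>One half of the exponential law, by the tube lemma: if \<open>q\<close> maps
  \<open>{z} \<times> K\<close> into the open set \<open>U\<close> with \<open>K\<close> compact, it
  also maps \<open>A \<times> K\<close> into \<open>U\<close> for a neighbourhood \<open>A\<close>
  of \<open>z\<close>.\<close>

lemma continuous_map_path_curry:
  assumes q: "continuous_map (prod_topology Z (top_of_set {0..1})) Y q"
  shows "continuous_map Z (path_topology Y) (\<lambda>z. \<lambda>t\<in>{0..1}. q (z, t))"
proof -
  let ?c = "\<lambda>z. \<lambda>t\<in>{0..1}. q (z, t)"
  let ?S = "{{f \<in> extensional {0..1}. continuous_map (top_of_set {0..1}) Y f \<and> f ` K \<subseteq> U} | K U.
          compactin (top_of_set {0..1::real}) K \<and> openin Y U}"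
  have path: "continuous_map (top_of_set {0..1}) Y (?c z)" if "z \<in> topspace Z" for z
  proof (rule continuous_map_eq)
    show "continuous_map (top_of_set {0..1}) Y (q \<circ> (\<lambda>t. (z, t)))"
      using that by (intro continuous_map_compose[OF _ q] continuous_map_pairedI) auto
  qed auto
  have "openin Z (?c -` V \<inter> topspace Z)" if V: "V \<in> ?S" for V
  proof -
    obtain K U where K: "compactin (top_of_set {0..1::real}) K" and U: "openin Y U"
      and V: "V = {f \<in> extensional {0..1}. continuous_map (top_of_set {0..1}) Y f \<and> f ` K \<subseteq> U}"
      using V by auto
    have K01: "K \<subseteq> {0..1}" using compactin_subset_topspace[OF K] by simp
    let ?P = "{p \<in> topspace (prod_topology Z (top_of_set {0..1})). q p \<in> U}"
    have P: "openin (prod_topology Z (top_of_set {0..1})) ?P"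
      by (rule openin_continuous_map_preimage[OF q U])
    show ?thesis
    proof (subst openin_subopen, intro ballI)
      fix z assume z: "z \<in> ?c -` V \<inter> topspace Z"
      have "(z, t) \<in> ?P" if "t \<in> K" for t
      proof -
        have "?c z \<in> V" using z by blast
        then have "?c z ` K \<subseteq> U" unfolding V by blast
        then have "?c z t \<in> U" using that by blast
        then have "q (z, t) \<in> U" using subsetD[OF K01 that] by simp
        then show ?thesis using z subsetD[OF K01 that] by simp
      qed
      then have "{z} \<times> K \<subseteq> ?P"
        by blast
      then obtain A B where AB: "openin Z A" "openin (top_of_set {0..1}) B" "{z} \<subseteq> A" "K \<subseteq> B"
          "A \<times> B \<subseteq> ?P"
        using Wallace_theorem_prod_topology[of Z "{z}" "top_of_set {0..1}" K ?P] K P z by auto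
      have "A \<subseteq> ?c -` V \<inter> topspace Z"
      proof
        fix a assume a: "a \<in> A"
        then have aZ: "a \<in> topspace Z" using AB(1) openin_subset by blast
        have "?c a t \<in> U" if "t \<in> K" for t
        proof -
          have "(a, t) \<in> ?P" using AB a that by blast
          then show ?thesis by simp
        qed
        then have "?c a ` K \<subseteq> U" by blast
        then show "a \<in> ?c -` V \<inter> topspace Z"
          using aZ path[OF aZ] by (simp add: V)
      qed
      then show "\<exists>T. openin Z T \<and> z \<in> T \<and> T \<subseteq> ?c -` V \<inter> topspace Z"
        using AB by blast
    qed
  qed
  moreover have "?c ` topspace Z \<subseteq> topspace (path_topology Y)"
    using path by (auto simp: topspace_path_topology)
  moreover have "path_topology Y = topology_generated_by ?S"
    by (simp add: path_topology_def compact_open_topology_def)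
  ultimately show ?thesis
    by (metis (no_types, lifting) continuous_on_generated_topo topology_generated_by_topspace)
qed

text \<open>The other half of the exponential law rests on local compactness of the interval: near
  \<open>(\<gamma>, t)\<close> the paths are controlled on a compact neighbourhood of
  \<open>t\<close> that \<gamma> maps into \<open>U\<close>.\<close>

lemma continuous_map_path_eval:
  "continuous_map (prod_topology (path_topology Y) (top_of_set {0..1})) Y (\<lambda>p. fst p (snd p))"
  unfolding continuous_map_def
proof (intro conjI allI impI)
  let ?PI = "prod_topology (path_topology Y) (top_of_set {0..1::real})"
  show "(\<lambda>p. fst p (snd p)) \<in> topspace ?PI \<rightarrow> topspace Y"
    by (force simp: topspace_path_topology continuous_map_def)
  fix U assume U: "openin Y U"
  show "openin ?PI {p \<in> topspace ?PI. fst p (snd p) \<in> U}"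
  proof (subst openin_subopen, intro ballI)
    fix p assume p: "p \<in> {p \<in> topspace ?PI. fst p (snd p) \<in> U}"
    obtain \<gamma> t where pe: "p = (\<gamma>, t)" by force
    have c: "continuous_map (top_of_set {0..1}) Y \<gamma>" and ex: "\<gamma> \<in> extensional {0..1}"
      and t: "t \<in> {0..1}" and gt: "\<gamma> t \<in> U"
      using p by (auto simp: pe topspace_path_topology)
    have "openin (top_of_set {0..1}) {s \<in> {0..1}. \<gamma> s \<in> U}"
      using openin_continuous_map_preimage[OF c U] by simp
    then obtain e where e: "e > 0" "\<forall>s\<in>{0..1}. dist s t < e \<longrightarrow> \<gamma> s \<in> U"
      unfolding openin_euclidean_subtopology_iff using t gt
      by (metis (mono_tags, lifting) mem_Collect_eq)
    \<comment> \<open>Half the radius keeps the closed ball inside the open \<open>e\<close>-ball,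
      while its interior still serves as the neighbourhood of \<open>t\<close>.\<close>
    define K where "K = cball t (e/2) \<inter> {0..1}"
    have K: "compactin (top_of_set {0..1}) K"
      by (simp add: K_def compactin_subtopology compact_Int)
    have gK: "\<gamma> ` K \<subseteq> U" using e by (auto simp: K_def dist_commute)
    define A where "A = {f \<in> extensional {0..1}. continuous_map (top_of_set {0..1}) Y f \<and> f ` K \<subseteq> U}"
    have "openin (path_topology Y) A"
      unfolding path_topology_def compact_open_topology_def A_def
      using K U by (intro topology_generated_by_Basis) auto
    moreover have "openin (top_of_set {0..1}) (ball t (e/2) \<inter> {0..1})"
      by (simp add: openin_open_Int Int_commute)
    ultimately have "openin ?PI (A \<times> (ball t (e/2) \<inter> {0..1}))"
      by (simp add: openin_prod_Times_iff)
    moreover have "p \<in> A \<times> (ball t (e/2) \<inter> {0..1})"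
      using c ex t gK e by (auto simp: pe A_def)
    moreover have "A \<times> (ball t (e/2) \<inter> {0..1}) \<subseteq> {p \<in> topspace ?PI. fst p (snd p) \<in> U}"
      by (auto simp: A_def K_def topspace_path_topology image_subset_iff)
    ultimately show "\<exists>T. openin ?PI T \<and> p \<in> T \<and> T \<subseteq> {p \<in> topspace ?PI. fst p (snd p) \<in> U}"
      by blast
  qed
qed

lemma continuous_map_fst': "continuous_map Z (prod_topology A B) f \<Longrightarrow> continuous_map Z A (\<lambda>z. fst (f z))"
  using continuous_map_fst_of[of Z A B f] by (simp add: o_def)

lemma continuous_map_snd': "continuous_map Z (prod_topology A B) f \<Longrightarrow> continuous_map Z B (\<lambda>z. snd (f z))"
  using continuous_map_snd_of[of Z A B f] by (simp add: o_def)

text \<open>Paths are \<open>undefined\<close> off the unit interval. Clamping the parameter lets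
  any continuous real expression be inserted into a path, with no side condition on its
  range.\<close>

definition clamp01 :: "real \<Rightarrow> real" where
  "clamp01 u = max 0 (min 1 u)"

lemma clamp01 [simp]: "t \<in> {0..1} \<Longrightarrow> clamp01 t = t" "clamp01 t \<in> {0..1}"
  "t \<le> 0 \<Longrightarrow> clamp01 t = 0" "1 \<le> t \<Longrightarrow> clamp01 t = 1"
  "0 \<le> clamp01 t" "clamp01 t \<le> 1"
  by (auto simp: clamp01_def)

lemma continuous_map_clamp01:
  assumes "continuous_map Z euclideanreal b"
  shows "continuous_map Z (top_of_set {0..1}) (\<lambda>z. clamp01 (b z))"
proof -
  have "continuous_map Z euclideanreal (\<lambda>z. clamp01 (b z))"
    unfolding clamp01_def
    by (intro continuous_map_real_max continuous_map_real_min assms) auto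
  then show ?thesis
    by (auto simp: continuous_map_in_subtopology)
qed

lemma continuous_map_path_apply:
  assumes "continuous_map Z (path_topology Y) a" "continuous_map Z euclideanreal b"
  shows "continuous_map Z Y (\<lambda>z. a z (clamp01 (b z)))"
  using continuous_map_compose[OF continuous_map_pairedI[OF assms(1) continuous_map_clamp01[OF assms(2)]]
      continuous_map_path_eval]
  by (simp add: o_def)

lemma continuous_map_homotopy_apply:
  assumes "continuous_map (prod_topology (top_of_set {0..1}) W) V K"
    and "continuous_map Z euclideanreal b" "continuous_map Z W a"
  shows "continuous_map Z V (\<lambda>z. K (clamp01 (b z), a z))"
  using continuous_map_compose[OF continuous_map_pairedI[OF continuous_map_clamp01[OF assms(2)] assms(3)]
      assms(1)]
  by (simp add: o_def)

lemma topspace_homotopy_fibre: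
  "topspace (homotopy_fibre X Y y0 g) =
     {(x, \<gamma>). x \<in> topspace X \<and> \<gamma> \<in> extensional {0..1} \<and> continuous_map (top_of_set {0..1}) Y \<gamma> \<and>
        \<gamma> 0 = y0 \<and> \<gamma> 1 = g x}"
  by (auto simp: homotopy_fibre_def topspace_path_topology)

lemma continuous_map_fibre_base:
  "continuous_map Z (homotopy_fibre X Y y0 g) f \<Longrightarrow> continuous_map Z X (\<lambda>z. fst (f z))"
  unfolding homotopy_fibre_def continuous_map_in_subtopology by (blast intro: continuous_map_fst')

lemma continuous_map_fibre_path:
  "continuous_map Z (homotopy_fibre X Y y0 g) f \<Longrightarrow> continuous_map Z (path_topology Y) (\<lambda>z. snd (f z))"
  unfolding homotopy_fibre_def continuous_map_in_subtopology by (blast intro: continuous_map_snd')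

text \<open>By currying, maps into a fibre are given by a function \<open>q\<close> of a point and a
  time; no later argument has to handle the compact-open topology itself.\<close>

lemma continuous_map_into_fibre:
  assumes "continuous_map Z X p" "continuous_map (prod_topology Z (top_of_set {0..1})) Y q"
    and "\<And>z. z \<in> topspace Z \<Longrightarrow> q (z, 0) = y0" "\<And>z. z \<in> topspace Z \<Longrightarrow> q (z, 1) = g (p z)"
  shows "continuous_map Z (homotopy_fibre X Y y0 g) (\<lambda>z. (p z, \<lambda>t\<in>{0..1}. q (z, t)))"
  unfolding homotopy_fibre_def
  using assms by (auto simp: continuous_map_in_subtopology intro!: continuous_map_pairedI continuous_map_path_curry)

lemma basepoint_in_fibre:
  assumes "pointed_map X x0 Y y0 g" "x0 \<in> topspace X" 
  shows "(x0, const_path y0) \<in> topspace (homotopy_fibre X Y y0 g)"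
proof -
  have "y0 \<in> topspace Y" using assms by (auto simp: pointed_map_def continuous_map_def)
  moreover have "continuous_map (top_of_set {0..1}) Y (\<lambda>t\<in>{0..1}. y0)"
    by (rule continuous_map_eq[of _ _ "\<lambda>_. y0"]) (use \<open>y0 \<in> topspace Y\<close> in auto)
  ultimately show ?thesis using assms
    by (auto simp: topspace_homotopy_fibre const_path_def pointed_map_def)
qed

section \<open>Pointed homotopy\<close>

lemma pointed_homotopic_refl: "pointed_map X x0 Y y0 f \<Longrightarrow> pointed_homotopic X x0 Y y0 f f"
  by (simp add: pointed_homotopic_def pointed_map_def)

lemma pointed_homotopic_equal:
  assumes "pointed_map X x0 Y y0 f" "x0 \<in> topspace X" "\<And>x. x \<in> topspace X \<Longrightarrow> f x = g x"
  shows "pointed_homotopic X x0 Y y0 f g"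
  using assms unfolding pointed_homotopic_def pointed_map_def
  by (intro homotopic_with_equal) auto

lemma pointed_homotopic_sym: "pointed_homotopic X x0 Y y0 f g \<Longrightarrow> pointed_homotopic X x0 Y y0 g f"
  by (simp add: pointed_homotopic_def homotopic_with_sym)

lemma pointed_homotopic_trans [trans]:
  "pointed_homotopic X x0 Y y0 f g \<Longrightarrow> pointed_homotopic X x0 Y y0 g h \<Longrightarrow> pointed_homotopic X x0 Y y0 f h"
  unfolding pointed_homotopic_def by (rule homotopic_with_trans)

lemma pointed_homotopic_imp_pointed_map:
  assumes "pointed_homotopic X x0 Y y0 f g"
  shows "pointed_map X x0 Y y0 f" "pointed_map X x0 Y y0 g"
  using assms homotopic_with_imp_continuous_maps homotopic_with_imp_property
  unfolding pointed_homotopic_def pointed_map_def by blast+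

lemma pointed_homotopic_compose_left:
  assumes "pointed_homotopic X x0 Y y0 f g" "pointed_map Y y0 Z z0 h"
  shows "pointed_homotopic X x0 Z z0 (h \<circ> f) (h \<circ> g)"
  using assms unfolding pointed_homotopic_def pointed_map_def
  by (auto intro: homotopic_with_compose_continuous_map_left)

lemma pointed_homotopic_compose_right:
  assumes "pointed_homotopic Y y0 Z z0 f g" "pointed_map X x0 Y y0 h"
  shows "pointed_homotopic X x0 Z z0 (f \<circ> h) (g \<circ> h)"
  using assms unfolding pointed_homotopic_def pointed_map_def
  by (auto intro: homotopic_with_compose_continuous_map_right)

lemma pointed_map_compose:
  "pointed_map X x0 Y y0 f \<Longrightarrow> pointed_map Y y0 Z z0 g \<Longrightarrow> pointed_map X x0 Z z0 (g \<circ> f)"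
  by (auto simp: pointed_map_def intro: continuous_map_compose)

lemma pointed_homotopy_equivalent_sym:
  "pointed_homotopy_equivalent X x0 Y y0 \<Longrightarrow> pointed_homotopy_equivalent Y y0 X x0"
  unfolding pointed_homotopy_equivalent_def by blast

lemma pointed_homotopy_equivalent_trans [trans]:
  assumes "pointed_homotopy_equivalent X x0 Y y0" "pointed_homotopy_equivalent Y y0 Z z0"
  shows "pointed_homotopy_equivalent X x0 Z z0"
proof -
  obtain u v where uv: "pointed_map X x0 Y y0 u" "pointed_map Y y0 X x0 v"
    "pointed_homotopic X x0 X x0 (v \<circ> u) id" "pointed_homotopic Y y0 Y y0 (u \<circ> v) id"
    using assms(1) unfolding pointed_homotopy_equivalent_def by blast
  obtain u' v' where uv': "pointed_map Y y0 Z z0 u'" "pointed_map Z z0 Y y0 v'"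
    "pointed_homotopic Y y0 Y y0 (v' \<circ> u') id" "pointed_homotopic Z z0 Z z0 (u' \<circ> v') id"
    using assms(2) unfolding pointed_homotopy_equivalent_def by blast
  have "pointed_homotopic X x0 X x0 (v \<circ> ((v' \<circ> u') \<circ> u)) (v \<circ> (id \<circ> u))"
    by (rule pointed_homotopic_compose_left[OF pointed_homotopic_compose_right[OF uv'(3) uv(1)] uv(2)])
  then have 1: "pointed_homotopic X x0 X x0 ((v \<circ> v') \<circ> (u' \<circ> u)) id"
    using pointed_homotopic_trans[OF _ uv(3)] by (simp add: o_assoc)
  have "pointed_homotopic Z z0 Z z0 (u' \<circ> ((u \<circ> v) \<circ> v')) (u' \<circ> (id \<circ> v'))"
    by (rule pointed_homotopic_compose_left[OF pointed_homotopic_compose_right[OF uv(4) uv'(2)] uv'(1)])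
  then have 2: "pointed_homotopic Z z0 Z z0 ((u' \<circ> u) \<circ> (v \<circ> v')) id"
    using pointed_homotopic_trans[OF _ uv'(4)] by (simp add: o_assoc)
  show ?thesis
    unfolding pointed_homotopy_equivalent_def
    using 1 2 pointed_map_compose[OF uv(1) uv'(1)] pointed_map_compose[OF uv'(2) uv(2)] by blast
qed

text \<open>Serves for vertical homotopies: the component \<open>p\<close> in \<open>X\<close> does
  not depend on the homotopy parameter \<open>s\<close>, and all motion is in the path
  \<open>q ((s, z), _)\<close>.\<close>

lemma fibre_homotopyI:
  assumes p: "continuous_map Z X p"
    and q: "continuous_map (prod_topology (prod_topology (top_of_set {0..1::real}) Z) (top_of_set {0..1})) Y q"
    and q0: "\<And>s z. s \<in> {0..1} \<Longrightarrow> z \<in> topspace Z \<Longrightarrow> q ((s, z), 0) = y0"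
    and q1: "\<And>s z. s \<in> {0..1} \<Longrightarrow> z \<in> topspace Z \<Longrightarrow> q ((s, z), 1) = g (p z)"
    and base: "\<And>s t. s \<in> {0..1} \<Longrightarrow> t \<in> {0..1} \<Longrightarrow> q ((s, z0), t) = y0" "p z0 = x0" "z0 \<in> topspace Z"
    and a: "\<And>z. z \<in> topspace Z \<Longrightarrow> a z = (p z, \<lambda>t\<in>{0..1}. q ((0, z), t))"
    and b: "\<And>z. z \<in> topspace Z \<Longrightarrow> b z = (p z, \<lambda>t\<in>{0..1}. q ((1, z), t))"
  shows "pointed_homotopic Z z0 (homotopy_fibre X Y y0 g) (x0, const_path y0) a b"
proof -
  let ?F = "homotopy_fibre X Y y0 g"
  let ?h = "\<lambda>w. (p (snd w), \<lambda>t\<in>{0..1}. q (w, t))"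
  have h: "continuous_map (prod_topology (top_of_set {0..1}) Z) ?F ?h"
    using p q q0 q1 by (intro continuous_map_into_fibre) (auto intro: continuous_map_compose[OF continuous_map_snd, unfolded o_def])
  have bp: "?h (s, z0) = (x0, const_path y0)" if "s \<in> {0..1}" for s
    using base that by (auto simp: const_path_def)
  have hom: "pointed_homotopic Z z0 ?F (x0, const_path y0) (\<lambda>z. ?h (0, z)) (\<lambda>z. ?h (1, z))"
    unfolding pointed_homotopic_def homotopic_with_def
  proof (rule exI[of _ ?h], intro conjI)
    show "\<forall>t\<in>{0..1}. ?h (t, z0) = (x0, const_path y0)" using bp by blast
  qed (rule h allI refl)+
  \<comment> \<open>A homotopy must have its prescribed ends at all arguments, also off the space,
    whereas \<open>a\<close> and \<open>b\<close> are known only on \<open>topspace Z\<close>; hence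
    the two corrections by equality on the space.\<close>
  have "pointed_homotopic Z z0 ?F (x0, const_path y0) (\<lambda>z. ?h (0, z)) a"
    by (rule pointed_homotopic_equal[OF pointed_homotopic_imp_pointed_map(1)[OF hom] base(3)])
      (simp only: a snd_conv)
  moreover have "pointed_homotopic Z z0 ?F (x0, const_path y0) (\<lambda>z. ?h (1, z)) b"
    by (rule pointed_homotopic_equal[OF pointed_homotopic_imp_pointed_map(2)[OF hom] base(3)])
      (simp only: b snd_conv)
  ultimately show ?thesis
    using pointed_homotopic_trans[OF pointed_homotopic_sym pointed_homotopic_trans[OF hom]] by blast
qed

lemma continuous_map_ident: "continuous_map Z Z (\<lambda>z. z)"
  by simp

lemma continuous_map_realI:
  "continuous_map Z (top_of_set S) b \<Longrightarrow> continuous_map Z euclideanreal b"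
  by (rule continuous_map_into_fulltopology)

section \<open>Homotopy invariance of the fibre\<close>

text \<open>\<open>\<gamma>\<close> followed by the track of \<open>x\<close> under \<open>H\<close>, parametrised by \<open>[0, 2]\<close>; it is constant outside.\<close>

definition ext_path :: "(real \<times> 'a \<Rightarrow> 'b) \<Rightarrow> 'a \<Rightarrow> (real \<Rightarrow> 'b) \<Rightarrow> real \<Rightarrow> 'b" where
  "ext_path H x \<gamma> u = (if u \<le> 1 then \<gamma> (clamp01 u) else H (clamp01 (u - 1), x))"

text \<open>The standard comparison of fibres of homotopic maps: appending the track of
  \<open>x\<close> moves the end of the path from \<open>H (0, x)\<close> to
  \<open>H (1, x)\<close>. The factor 2 runs through both pieces in unit time.\<close>

definition fibre_transport :: "(real \<times> 'a \<Rightarrow> 'b) \<Rightarrow> 'a \<times> (real \<Rightarrow> 'b) \<Rightarrow> 'a \<times> (real \<Rightarrow> 'b)" where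
  "fibre_transport H p = (fst p, \<lambda>t\<in>{0..1}. ext_path H (fst p) (snd p) (2 * t))"

definition fibre_post :: "('b \<Rightarrow> 'c) \<Rightarrow> 'a \<times> (real \<Rightarrow> 'b) \<Rightarrow> 'a \<times> (real \<Rightarrow> 'c)" where
  "fibre_post \<phi> p = (fst p, \<lambda>t\<in>{0..1}. \<phi> (snd p t))"

lemma continuous_map_ext_path:
  assumes H: "continuous_map (prod_topology (top_of_set {0..1}) X) W H"
    and c: "continuous_map Z (path_topology W) c" and p: "continuous_map Z X p"
    and b: "continuous_map Z euclideanreal b"
    and eq: "\<And>z. z \<in> topspace Z \<Longrightarrow> c z 1 = H (0, p z)"
  shows "continuous_map Z W (\<lambda>z. ext_path H (p z) (c z) (b z))"
  unfolding ext_path_def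
proof (rule continuous_map_cases_le)
  show "continuous_map (subtopology Z {x \<in> topspace Z. b x \<le> 1}) W (\<lambda>z. c z (clamp01 (b z)))"
    by (rule continuous_map_from_subtopology[OF continuous_map_path_apply[OF c b]])
  have "continuous_map Z euclideanreal (\<lambda>z. b z - 1)"
    by (intro continuous_intros b) auto
  then show "continuous_map (subtopology Z {x \<in> topspace Z. 1 \<le> b x}) W (\<lambda>z. H (clamp01 (b z - 1), p z))"
    by (intro continuous_map_from_subtopology continuous_map_homotopy_apply[OF H _ p])
qed (use b eq in auto)

lemma pointed_map_fibre_transport:
  assumes H: "continuous_map (prod_topology (top_of_set {0..1}) X) W H"
    and base: "\<And>t. t \<in> {0..1} \<Longrightarrow> H (t, x0) = w0"
    and H0: "\<And>x. x \<in> topspace X \<Longrightarrow> H (0, x) = g x"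
    and H1: "\<And>x. x \<in> topspace X \<Longrightarrow> H (1, x) = g' x"
  shows "pointed_map (homotopy_fibre X W w0 g) (x0, const_path w0)
           (homotopy_fibre X W w0 g') (x0, const_path w0) (fibre_transport H)"
proof -
  let ?F = "homotopy_fibre X W w0 g"
  let ?q = "\<lambda>w. ext_path H (fst (fst w)) (snd (fst w)) (2 * snd w)"
  have q: "continuous_map (prod_topology ?F (top_of_set {0..1})) W ?q"
  proof (rule continuous_map_ext_path[OF H])
    show "continuous_map (prod_topology ?F (top_of_set {0..1})) (path_topology W) (\<lambda>z. snd (fst z))"
      by (rule continuous_map_fibre_path[OF continuous_map_fst'[OF continuous_map_ident]])
    show "continuous_map (prod_topology ?F (top_of_set {0..1})) X (\<lambda>z. fst (fst z))"
      by (rule continuous_map_fibre_base[OF continuous_map_fst'[OF continuous_map_ident]])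
    show "continuous_map (prod_topology ?F (top_of_set {0..1})) euclideanreal (\<lambda>w. 2 * snd w)"
      by (intro continuous_map_real_mult_left continuous_map_realI[OF continuous_map_snd'[OF continuous_map_ident]])
  qed (auto simp: topspace_homotopy_fibre H0)
  have "continuous_map ?F (homotopy_fibre X W w0 g') (\<lambda>z. (fst z, \<lambda>t\<in>{0..1}. ?q (z, t)))"
    by (rule continuous_map_into_fibre[OF continuous_map_fibre_base[OF continuous_map_ident] q])
      (auto simp: topspace_homotopy_fibre H1 ext_path_def)
  then show ?thesis
    by (auto simp: pointed_map_def fibre_transport_def[abs_def] ext_path_def const_path_def base)
qed

lemma fibre_transport_inverse:
  fixes X :: "'a topology" and W :: "'b topology"
  assumes H: "continuous_map (prod_topology (top_of_set {0..1}) X) W H"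
    and base: "\<And>t. t \<in> {0..1} \<Longrightarrow> H (t, x0) = w0"
    and H0: "\<And>x. x \<in> topspace X \<Longrightarrow> H (0, x) = g x"
    and H': "\<And>t x. t \<in> {0..1} \<Longrightarrow> H' (t, x) = H (1 - t, x)"
    and x0: "x0 \<in> topspace X" and w0: "w0 \<in> topspace W"
  shows "pointed_homotopic (homotopy_fibre X W w0 g) (x0, const_path w0)
           (homotopy_fibre X W w0 g) (x0, const_path w0) (fibre_transport H' \<circ> fibre_transport H) id"
proof -
  let ?F = "homotopy_fibre X W w0 g"
  let ?I = "top_of_set {0..1::real}"
  let ?Z = "prod_topology (prod_topology ?I ?F) ?I"
  \<comment> \<open>The composite runs along \<open>ext_path\<close> with the parameter \<open>min (4 t) (3 - 2 t)\<close>, which is then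
    deformed linearly into \<open>t\<close>.\<close>
  let ?b = "\<lambda>w. (1 - fst (fst w)) * min (4 * snd w) (3 - 2 * snd w) + fst (fst w) * snd w"
  let ?q = "\<lambda>w::(real \<times> 'a \<times> (real \<Rightarrow> 'b)) \<times> real. ext_path H (fst (snd (fst w))) (snd (snd (fst w))) (?b w)"
  have g0: "g x0 = w0" using H0[OF x0] base[of 0] by simp
  have s: "continuous_map ?Z euclideanreal (\<lambda>w. fst (fst w))"
    by (rule continuous_map_realI[OF continuous_map_fst'[OF continuous_map_fst'[OF continuous_map_ident]]])
  have t: "continuous_map ?Z euclideanreal snd"
    using continuous_map_realI[OF continuous_map_snd] .
  have b: "continuous_map ?Z euclideanreal ?b"
    by (intro continuous_map_add continuous_map_real_mult continuous_map_diff continuous_map_real_min s t) auto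
  have q: "continuous_map ?Z W ?q"
  proof (rule continuous_map_ext_path[OF H])
    show "continuous_map ?Z (path_topology W) (\<lambda>w. snd (snd (fst w)))"
      by (rule continuous_map_fibre_path[OF continuous_map_snd'[OF continuous_map_fst'[OF continuous_map_ident]]])
    show "continuous_map ?Z X (\<lambda>w. fst (snd (fst w)))"
      by (rule continuous_map_fibre_base[OF continuous_map_snd'[OF continuous_map_fst'[OF continuous_map_ident]]])
  qed (auto simp: topspace_homotopy_fibre H0 b)
  show ?thesis
  proof (rule fibre_homotopyI[OF continuous_map_fibre_base[OF continuous_map_ident] q])
    fix s z assume sz: "s \<in> {0..1::real}" "z \<in> topspace ?F"
    show "?q ((s, z), 0) = w0" "?q ((s, z), 1) = g (fst z)"
      using sz by (auto simp: topspace_homotopy_fibre ext_path_def)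
  next
    fix s t :: real assume st: "s \<in> {0..1}" "t \<in> {0..1}"
    show "?q ((s, (x0, const_path w0)), t) = w0"
      using clamp01(2) by (simp add: ext_path_def const_path_def base)
  next
    show "(x0, const_path w0) \<in> topspace ?F"
      using x0 w0 g0 by (auto simp: topspace_homotopy_fibre const_path_def 
        intro!: continuous_map_eq[of _ _ "\<lambda>_. w0"])
  next
    fix z assume z: "z \<in> topspace ?F"
    obtain x \<gamma> where ze: "z = (x, \<gamma>)" by force
    have x: "x \<in> topspace X" and \<gamma>: "\<gamma> \<in> extensional {0..1}" "\<gamma> 1 = H (0, x)"
      using z by (auto simp: ze topspace_homotopy_fibre H0)
    \<comment> \<open>Up to time 1/2 the speed is doubled twice, which gives \<open>4 * t\<close>.
      After that the reversed track is at \<open>H (2 - 2 * t, x)\<close>, which is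
      \<open>ext_path\<close> at \<open>3 - 2 * t\<close>. Both expressions equal 2 at time
      1/2.\<close>
    have "ext_path H' x (\<lambda>t\<in>{0..1}. ext_path H x \<gamma> (2 * t)) (2 * t) = ext_path H x \<gamma> (min (4 * t) (3 - 2 * t))"
      if t: "t \<in> {0..1}" for t
    proof (cases "t \<le> 1/2")
      case True
      then show ?thesis using t by (simp add: ext_path_def min_def)
    next
      case False
      \<comment> \<open>At \<open>t = 1\<close> the parameter is 1, where \<open>ext_path\<close>
        takes its value from \<gamma> and not from \<open>H\<close>;
        \<open>\<gamma> 1 = H (0, x)\<close> reconciles the two.\<close>
      then show ?thesis using t \<gamma>(2) by (cases "t = 1") (auto simp: ext_path_def min_def H' algebra_simps)
    qed
    then show "(fibre_transport H' \<circ> fibre_transport H) z = (fst z, \<lambda>t\<in>{0..1}. ?q ((0, z), t))"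
      by (auto simp: fibre_transport_def ze intro!: restrict_ext)
    show "id z = (fst z, \<lambda>t\<in>{0..1}. ?q ((1, z), t))"
      using \<gamma>(1) by (auto simp: ze ext_path_def extensional_def fun_eq_iff)
  qed auto
qed

text \<open>Transport along the reversed homotopy is the inverse; reversal is an involution on the
  unit interval, so one cancellation lemma covers both composites.\<close>

lemma homotopy_fibre_homotopic_equivalent:
  assumes "pointed_homotopic X x0 W w0 g g'" and x0: "x0 \<in> topspace X" and w0: "w0 \<in> topspace W"
  shows "pointed_homotopy_equivalent (homotopy_fibre X W w0 g) (x0, const_path w0)
           (homotopy_fibre X W w0 g') (x0, const_path w0)"
proof -
  obtain H where H: "continuous_map (prod_topology (top_of_set {0..1::real}) X) W H"
    "\<And>x. H (0, x) = g x" "\<And>x. H (1, x) = g' x" "\<And>t. t \<in> {0..1} \<Longrightarrow> H (t, x0) = w0"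
    using assms(1) unfolding pointed_homotopic_def homotopic_with_def by blast
  let ?H' = "\<lambda>p. H (clamp01 (1 - fst p), snd p)"
  have H': "continuous_map (prod_topology (top_of_set {0..1::real}) X) W ?H'"
    by (intro continuous_map_homotopy_apply[OF H(1)] continuous_map_diff continuous_map_snd 
        continuous_map_realI[OF continuous_map_fst]) auto
  have 1: "pointed_map (homotopy_fibre X W w0 g) (x0, const_path w0)
           (homotopy_fibre X W w0 g') (x0, const_path w0) (fibre_transport H)"
    using H by (intro pointed_map_fibre_transport) auto
  have 2: "pointed_map (homotopy_fibre X W w0 g') (x0, const_path w0)
           (homotopy_fibre X W w0 g) (x0, const_path w0) (fibre_transport ?H')"
    using H H' by (intro pointed_map_fibre_transport) auto
  have 3: "pointed_homotopic (homotopy_fibre X W w0 g) (x0, const_path w0)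
           (homotopy_fibre X W w0 g) (x0, const_path w0) (fibre_transport ?H' \<circ> fibre_transport H) id"
    using H x0 w0 by (intro fibre_transport_inverse) auto
  have 4: "pointed_homotopic (homotopy_fibre X W w0 g') (x0, const_path w0)
           (homotopy_fibre X W w0 g') (x0, const_path w0) (fibre_transport H \<circ> fibre_transport ?H') id"
    using H H' x0 w0 by (intro fibre_transport_inverse[OF H']) auto
  show ?thesis
    unfolding pointed_homotopy_equivalent_def using 1 2 3 4 by blast
qed

lemma pointed_map_fibre_post:
  assumes \<phi>: "pointed_map W w0 V v0 \<phi>"
  shows "pointed_map (homotopy_fibre X W w0 g) (x0, const_path w0)
           (homotopy_fibre X V v0 (\<phi> \<circ> g)) (x0, const_path v0) (fibre_post \<phi>)"
proof -
  let ?F = "homotopy_fibre X W w0 g"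
  let ?q = "\<lambda>w. \<phi> (snd (fst w) (clamp01 (snd w)))"
  have c: "continuous_map W V \<phi>" and b: "\<phi> w0 = v0" using \<phi> by (auto simp: pointed_map_def)
  have "continuous_map (prod_topology ?F (top_of_set {0..1::real})) W (\<lambda>w. snd (fst w) (clamp01 (snd w)))"
    by (rule continuous_map_path_apply[OF continuous_map_fibre_path[OF continuous_map_fst'[OF continuous_map_ident]]
       continuous_map_realI[OF continuous_map_snd]])
  then have q: "continuous_map (prod_topology ?F (top_of_set {0..1::real})) V ?q"
    using continuous_map_compose[OF _ c] by (simp add: o_def)
  have "continuous_map ?F (homotopy_fibre X V v0 (\<phi> \<circ> g)) (\<lambda>z. (fst z, \<lambda>t\<in>{0..1}. ?q (z, t)))"
    by (rule continuous_map_into_fibre[OF continuous_map_fibre_base[OF continuous_map_ident] q])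
      (use b in \<open>auto simp: topspace_homotopy_fibre\<close>)
  moreover have "(\<lambda>z. (fst z, \<lambda>t\<in>{0..1}. ?q (z, t))) = fibre_post \<phi>"
    by (auto simp: fibre_post_def fun_eq_iff)
  ultimately have "continuous_map ?F (homotopy_fibre X V v0 (\<phi> \<circ> g)) (fibre_post \<phi>)"
    by (rule back_subst)
  then show ?thesis
    by (auto simp: pointed_map_def fibre_post_def const_path_def b)
qed

text \<open>For a point \<open>(x, \<gamma>)\<close> consider the square
  \<open>(a, b) \<mapsto> K (a, \<gamma> b)\<close>. The composite follows its edge
  \<open>a = 0\<close> and then its edge \<open>b = 1\<close>, while \<gamma> is its edge
  \<open>a = 1\<close>. Both routes end at the corner \<open>(1, 1)\<close>, and the edge
  \<open>b = 0\<close>, along which the starting point slides, is sent to \<open>w0\<close> because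
  \<open>K\<close> is pointed.\<close>

lemma fibre_post_left_inverse:
  fixes X :: "'a topology" and W :: "'b topology"
  assumes K: "continuous_map (prod_topology (top_of_set {0..1}) W) W K"
    and base: "\<And>t. t \<in> {0..1} \<Longrightarrow> K (t, w0) = w0"
    and K0: "\<And>w. w \<in> topspace W \<Longrightarrow> K (0, w) = \<psi> (\<phi> w)" and K1: "\<And>w. w \<in> topspace W \<Longrightarrow> K (1, w) = w"
    and g: "pointed_map X x0 W w0 g" and x0: "x0 \<in> topspace X"
  shows "pointed_homotopic (homotopy_fibre X W w0 g) (x0, const_path w0)
           (homotopy_fibre X W w0 g) (x0, const_path w0)
           (fibre_transport (\<lambda>p. K (fst p, g (snd p))) \<circ> (fibre_post \<psi> \<circ> fibre_post \<phi>)) id"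
proof -
  let ?F = "homotopy_fibre X W w0 g"
  let ?I = "top_of_set {0..1::real}"
  let ?Z = "prod_topology (prod_topology ?I ?F) ?I"
  \<comment> \<open>Straight-line deformation, inside the square, of the route
    \<open>(max 0 (2 * t - 1), min 1 (2 * t))\<close> along two edges into the route
    \<open>(1, t)\<close>.\<close>
  let ?q = "\<lambda>w::(real \<times> 'a \<times> (real \<Rightarrow> 'b)) \<times> real.
     K (clamp01 ((1 - fst (fst w)) * max 0 (2 * snd w - 1) + fst (fst w)),
        snd (snd (fst w)) (clamp01 ((1 - fst (fst w)) * min 1 (2 * snd w) + fst (fst w) * snd w)))"
  have s: "continuous_map ?Z euclideanreal (\<lambda>w. fst (fst w))"
    by (rule continuous_map_realI[OF continuous_map_fst'[OF continuous_map_fst'[OF continuous_map_ident]]])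
  have t: "continuous_map ?Z euclideanreal snd"
    using continuous_map_realI[OF continuous_map_snd] .
  have q: "continuous_map ?Z W ?q"
  proof (rule continuous_map_homotopy_apply[OF K _ continuous_map_path_apply])
    show "continuous_map ?Z (path_topology W) (\<lambda>w. snd (snd (fst w)))"
      by (rule continuous_map_fibre_path[OF continuous_map_snd'[OF continuous_map_fst'[OF continuous_map_ident]]])
  qed (intro continuous_map_add continuous_map_real_mult continuous_map_diff continuous_map_real_min
      continuous_map_real_max s t; simp)+
  show ?thesis
  proof (rule fibre_homotopyI[OF continuous_map_fibre_base[OF continuous_map_ident] q])
    fix s z assume sz: "s \<in> {0..1::real}" "z \<in> topspace ?F"
    have "g (fst z) \<in> topspace W" using sz g
      by (auto simp: topspace_homotopy_fibre pointed_map_def continuous_map_def)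
    then show "?q ((s, z), 0) = w0" "?q ((s, z), 1) = g (fst z)"
      using sz base[of s] by (auto simp: topspace_homotopy_fibre K1)
  next
    fix s t :: real assume st: "s \<in> {0..1}" "t \<in> {0..1}"
    show "?q ((s, (x0, const_path w0)), t) = w0"
      using clamp01(2) by (simp add: const_path_def base)
  next
    show "(x0, const_path w0) \<in> topspace ?F" by (rule basepoint_in_fibre[OF g x0])
  next
    fix z assume z: "z \<in> topspace ?F"
    obtain x \<gamma> where ze: "z = (x, \<gamma>)" by force
    have x: "x \<in> topspace X" and \<gamma>: "\<gamma> \<in> extensional {0..1}" "\<gamma> 1 = g x"
      "\<And>t. t \<in> {0..1} \<Longrightarrow> \<gamma> t \<in> topspace W"
      using z by (auto simp: ze topspace_homotopy_fibre continuous_map_def)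
    have "ext_path (\<lambda>p. K (fst p, g (snd p))) x (\<lambda>t\<in>{0..1}. \<psi> (\<phi> (\<gamma> t))) (2 * t) =
        K (clamp01 (max 0 (2 * t - 1)), \<gamma> (clamp01 (min 1 (2 * t))))"
      if t: "t \<in> {0..1}" for t
    proof (cases t "1/2 :: real" rule: linorder_cases)
      case less
      then show ?thesis using t \<gamma>(3) by (simp add: ext_path_def max_def min_def K0)
    next
      case equal
      show ?thesis unfolding equal using \<gamma>(3)[of 1] K0[of "\<gamma> 1"] by (simp add: ext_path_def)
    next
      case greater
      then show ?thesis using t \<gamma>(2) by (simp add: ext_path_def max_def min_def)
    qed
    then show "(fibre_transport (\<lambda>p. K (fst p, g (snd p))) \<circ> (fibre_post \<psi> \<circ> fibre_post \<phi>)) z =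
        (fst z, \<lambda>t\<in>{0..1}. ?q ((0, z), t))"
      by (auto simp: fibre_transport_def fibre_post_def ze restrict_def fun_eq_iff cong: if_cong)
    show "id z = (fst z, \<lambda>t\<in>{0..1}. ?q ((1, z), t))"
      using \<gamma> by (auto simp: ze extensional_def fun_eq_iff K1)
  qed auto
qed

text \<open>Avoids choosing the homotopies \<open>\<psi> \<circ> \<phi> \<simeq> id\<close> and \<open>\<phi> \<circ> \<psi> \<simeq> id\<close>
  compatibly in \<open>homotopy_fibre_post_equivalent\<close> below.\<close>

lemma pointed_homotopy_equivalent_cancel:
  assumes A: "pointed_map Q q0 R r0 A" and B: "pointed_map R r0 Q q0 B"
    and \<Psi>: "pointed_map P p0 Q q0 \<Psi>" and \<Phi>: "pointed_map R r0 P p0 \<Phi>" and L: "pointed_map Q q0 P p0 L"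
    and BA: "pointed_homotopic Q q0 Q q0 (B \<circ> A) id"
    and A\<Psi>\<Phi>: "pointed_homotopic R r0 R r0 (A \<circ> (\<Psi> \<circ> \<Phi>)) id"
    and L\<Psi>: "pointed_homotopic P p0 P p0 (L \<circ> \<Psi>) id"
  shows "pointed_homotopy_equivalent P p0 R r0"
proof -
  note left = pointed_homotopic_compose_left and right = pointed_homotopic_compose_right
  have "pointed_homotopic R r0 Q q0 (B \<circ> A \<circ> (\<Psi> \<circ> \<Phi>)) (id \<circ> (\<Psi> \<circ> \<Phi>))"
    by (rule right[OF BA pointed_map_compose[OF \<Phi> \<Psi>]])
  moreover have "pointed_homotopic R r0 Q q0 (B \<circ> (A \<circ> (\<Psi> \<circ> \<Phi>))) (B \<circ> id)"
    by (rule left[OF A\<Psi>\<Phi> B])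
  \<comment> \<open>\<open>A\<close> has the left inverse \<open>B\<close> and the right inverse
    \<open>\<Psi> \<circ> \<Phi>\<close>, so the two agree up to homotopy.\<close>
  ultimately have \<Psi>\<Phi>: "pointed_homotopic R r0 Q q0 (\<Psi> \<circ> \<Phi>) B"
    by (auto simp: o_assoc intro: pointed_homotopic_trans pointed_homotopic_sym)
  have A\<Psi>: "pointed_map P p0 R r0 (A \<circ> \<Psi>)" by (rule pointed_map_compose[OF \<Psi> A])
  have "pointed_homotopic P p0 P p0 (L \<circ> \<Psi> \<circ> (\<Phi> \<circ> (A \<circ> \<Psi>))) (id \<circ> (\<Phi> \<circ> (A \<circ> \<Psi>)))"
    by (rule right[OF L\<Psi> pointed_map_compose[OF A\<Psi> \<Phi>]])
  moreover have "pointed_homotopic P p0 P p0 (L \<circ> (\<Psi> \<circ> \<Phi> \<circ> (A \<circ> \<Psi>))) (L \<circ> (B \<circ> (A \<circ> \<Psi>)))"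
    by (rule left[OF right[OF \<Psi>\<Phi> A\<Psi>] L])
  moreover have "pointed_homotopic P p0 P p0 (L \<circ> (B \<circ> A \<circ> \<Psi>)) (L \<circ> (id \<circ> \<Psi>))"
    by (rule left[OF right[OF BA \<Psi>] L])
  \<comment> \<open>Cancelling on the left with \<open>L\<close>: after \<Psi>, the map
    \<open>\<Phi> \<circ> A \<circ> \<Psi>\<close> becomes
    \<open>B \<circ> A \<circ> \<Psi>\<close>, hence \<Psi>.\<close>
  ultimately have "pointed_homotopic P p0 P p0 (\<Phi> \<circ> (A \<circ> \<Psi>)) id"
    using L\<Psi> by (simp add: o_assoc) (blast intro: pointed_homotopic_trans pointed_homotopic_sym)
  moreover have "pointed_homotopic R r0 R r0 (A \<circ> \<Psi> \<circ> \<Phi>) id"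
    using A\<Psi>\<Phi> by (simp add: o_assoc)
  ultimately show ?thesis
    unfolding pointed_homotopy_equivalent_def using A\<Psi> \<Phi> by blast
qed

text \<open>The cancellation is applied with \<open>P\<close>, \<open>Q\<close>, \<open>R\<close>
  the fibres of \<open>\<phi> \<circ> g\<close>, \<open>\<psi> \<circ> \<phi> \<circ> g\<close> and
  \<open>g\<close>. Here \<open>A\<close> and \<open>B\<close> are the transports along
  \<open>K\<close> and along its reverse, and the remaining two homotopies are one lemma used for
  \<phi>, \<psi> in both orders.\<close>

lemma homotopy_fibre_post_equivalent:
  assumes g: "pointed_map X x0 W w0 g" and x0: "x0 \<in> topspace X"
    and \<phi>: "pointed_map W w0 V v0 \<phi>" and \<psi>: "pointed_map V v0 W w0 \<psi>"
    and \<psi>\<phi>: "pointed_homotopic W w0 W w0 (\<psi> \<circ> \<phi>) id"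
    and \<phi>\<psi>: "pointed_homotopic V v0 V v0 (\<phi> \<circ> \<psi>) id"
  shows "pointed_homotopy_equivalent (homotopy_fibre X V v0 (\<phi> \<circ> g)) (x0, const_path v0)
           (homotopy_fibre X W w0 g) (x0, const_path w0)"
proof -
  have w0: "w0 \<in> topspace W" and v0: "v0 \<in> topspace V"
    using g \<phi> x0 by (auto simp: pointed_map_def continuous_map_def)
  obtain K where K: "continuous_map (prod_topology (top_of_set {0..1::real}) W) W K"
    "\<And>x. K (0, x) = \<psi> (\<phi> x)" "\<And>x. K (1, x) = x" "\<And>t. t \<in> {0..1} \<Longrightarrow> K (t, w0) = w0"
    using \<psi>\<phi> unfolding pointed_homotopic_def homotopic_with_def by auto
  obtain K' where K': "continuous_map (prod_topology (top_of_set {0..1::real}) V) V K'"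
    "\<And>x. K' (0, x) = \<phi> (\<psi> x)" "\<And>x. K' (1, x) = x" "\<And>t. t \<in> {0..1} \<Longrightarrow> K' (t, v0) = v0"
    using \<phi>\<psi> unfolding pointed_homotopic_def homotopic_with_def by auto
  have gc: "continuous_map X W g" "g x0 = w0" using g by (auto simp: pointed_map_def)
  let ?H = "\<lambda>p. K (fst p, g (snd p))"
  let ?H1 = "\<lambda>p. K (clamp01 (1 - fst p), g (snd p))"
  let ?H' = "\<lambda>p. K' (fst p, (\<phi> \<circ> g) (snd p))"
  have gs: "continuous_map (prod_topology (top_of_set {0..1::real}) X) W (\<lambda>p. g (snd p))"
    using continuous_map_compose[OF continuous_map_snd gc(1)] by (simp add: o_def)
  have H: "continuous_map (prod_topology (top_of_set {0..1::real}) X) W ?H"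
    using continuous_map_compose[OF continuous_map_pairedI[OF continuous_map_fst gs] K(1)]
    by (simp add: o_def)
  have H1: "continuous_map (prod_topology (top_of_set {0..1::real}) X) W ?H1"
    by (intro continuous_map_homotopy_apply[OF K(1)] continuous_map_diff gs
        continuous_map_realI[OF continuous_map_fst]) auto
  have \<phi>g: "pointed_map X x0 V v0 (\<phi> \<circ> g)" by (rule pointed_map_compose[OF g \<phi>])
  have "continuous_map (prod_topology (top_of_set {0..1::real}) X) V (\<lambda>p. (\<phi> \<circ> g) (snd p))"
    using continuous_map_compose[OF continuous_map_snd, of X V "\<phi> \<circ> g"] \<phi>g
    by (simp add: o_def pointed_map_def)
  from continuous_map_compose[OF continuous_map_pairedI[OF continuous_map_fst this] K'(1)]
  have H': "continuous_map (prod_topology (top_of_set {0..1::real}) X) V ?H'"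
    by (simp add: o_def)
  show ?thesis
  proof (rule pointed_homotopy_equivalent_cancel)
    show "pointed_map (homotopy_fibre X W w0 (\<psi> \<circ> (\<phi> \<circ> g))) (x0, const_path w0)
        (homotopy_fibre X W w0 g) (x0, const_path w0) (fibre_transport ?H)"
      using K gc by (intro pointed_map_fibre_transport[OF H]) auto
    show "pointed_map (homotopy_fibre X W w0 g) (x0, const_path w0)
        (homotopy_fibre X W w0 (\<psi> \<circ> (\<phi> \<circ> g))) (x0, const_path w0) (fibre_transport ?H1)"
      using K gc by (intro pointed_map_fibre_transport[OF H1]) auto
    show "pointed_map (homotopy_fibre X V v0 (\<phi> \<circ> g)) (x0, const_path v0)
        (homotopy_fibre X W w0 (\<psi> \<circ> (\<phi> \<circ> g))) (x0, const_path w0) (fibre_post \<psi>)"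
      by (rule pointed_map_fibre_post[OF \<psi>])
    show "pointed_map (homotopy_fibre X W w0 g) (x0, const_path w0)
        (homotopy_fibre X V v0 (\<phi> \<circ> g)) (x0, const_path v0) (fibre_post \<phi>)"
      by (rule pointed_map_fibre_post[OF \<phi>])
    \<comment> \<open>The left inverse \<open>L\<close> of post-composition with \<psi>: applying
      \<phi> once more leads to the fibre of
      \<open>\<phi> \<circ> \<psi> \<circ> \<phi> \<circ> g\<close>, and \<open>K'\<close> leads
      back.\<close>
    show "pointed_map (homotopy_fibre X W w0 (\<psi> \<circ> (\<phi> \<circ> g))) (x0, const_path w0)
        (homotopy_fibre X V v0 (\<phi> \<circ> g)) (x0, const_path v0) (fibre_transport ?H' \<circ> fibre_post \<phi>)"
    proof (rule pointed_map_compose[OF pointed_map_fibre_post[OF \<phi>]])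
      show "pointed_map (homotopy_fibre X V v0 (\<phi> \<circ> (\<psi> \<circ> (\<phi> \<circ> g)))) (x0, const_path v0)
          (homotopy_fibre X V v0 (\<phi> \<circ> g)) (x0, const_path v0) (fibre_transport ?H')"
        using K' \<phi>g by (intro pointed_map_fibre_transport[OF H']) (auto simp: pointed_map_def)
    qed
    show "pointed_homotopic (homotopy_fibre X W w0 (\<psi> \<circ> (\<phi> \<circ> g))) (x0, const_path w0)
        (homotopy_fibre X W w0 (\<psi> \<circ> (\<phi> \<circ> g))) (x0, const_path w0)
        (fibre_transport ?H1 \<circ> fibre_transport ?H) id"
      using K gc x0 w0 by (intro fibre_transport_inverse[OF H]) auto
    show "pointed_homotopic (homotopy_fibre X W w0 g) (x0, const_path w0)
        (homotopy_fibre X W w0 g) (x0, const_path w0)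
        (fibre_transport ?H \<circ> (fibre_post \<psi> \<circ> fibre_post \<phi>)) id"
      by (rule fibre_post_left_inverse[OF K(1) _ _ _ g x0]) (auto simp: K)
    show "pointed_homotopic (homotopy_fibre X V v0 (\<phi> \<circ> g)) (x0, const_path v0)
        (homotopy_fibre X V v0 (\<phi> \<circ> g)) (x0, const_path v0)
        (fibre_transport ?H' \<circ> fibre_post \<phi> \<circ> fibre_post \<psi>) id"
      unfolding o_assoc[symmetric] by (rule fibre_post_left_inverse[OF K'(1) _ _ _ \<phi>g x0]) (auto simp: K')
  qed
qed

section \<open>Splitting loop spaces off the fibre of a map into one axis of the power\<close>

lemma pointed_map_basepoint:
  "pointed_map X x0 Y y0 f \<Longrightarrow> x0 \<in> topspace X \<Longrightarrow> y0 \<in> topspace Y"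
  by (auto simp: pointed_map_def continuous_map_def)

lemma pointed_homotopy_equivalentI_homeo:
  assumes u: "pointed_map X x0 Y y0 u" and v: "pointed_map Y y0 X x0 v"
    and "x0 \<in> topspace X" "y0 \<in> topspace Y"
    and "\<And>x. x \<in> topspace X \<Longrightarrow> v (u x) = x" "\<And>y. y \<in> topspace Y \<Longrightarrow> u (v y) = y"
  shows "pointed_homotopy_equivalent X x0 Y y0"
  unfolding pointed_homotopy_equivalent_def
  using assms pointed_map_compose[OF u v] pointed_map_compose[OF v u]
  by (intro exI[of _ u] exI[of _ v] conjI pointed_homotopic_equal) auto

lemma continuous_map_into_product:
  assumes "\<And>j. j \<in> I \<Longrightarrow> continuous_map Z (Y j) (f j)"
  shows "continuous_map Z (product_topology Y I) (\<lambda>z. \<lambda>j\<in>I. f j z)"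
  using assms by (auto simp: continuous_map_componentwise)

lemma continuous_map_product_apply:
  assumes "continuous_map Z (product_topology Y I) f" "j \<in> I"
  shows "continuous_map Z (Y j) (\<lambda>z. f z j)"
  using assms by (auto simp: continuous_map_componentwise)

lemma continuous_map_into_loop:
  assumes "continuous_map (prod_topology Z (top_of_set {0..1})) Y q"
    and "\<And>z. z \<in> topspace Z \<Longrightarrow> q (z, 0) = y0" "\<And>z. z \<in> topspace Z \<Longrightarrow> q (z, 1) = y0"
  shows "continuous_map Z (loop_topology Y y0) (\<lambda>z. \<lambda>t\<in>{0..1}. q (z, t))"
  unfolding loop_topology_def
  using assms by (auto simp: continuous_map_in_subtopology intro!: continuous_map_path_curry)

lemma continuous_map_loop_path:
  "continuous_map Z (loop_topology Y y0) f \<Longrightarrow> continuous_map Z (path_topology Y) f"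
  unfolding loop_topology_def by (simp add: continuous_map_in_subtopology)

lemma topspace_loop_topology:
  "topspace (loop_topology Y y0) =
     {\<gamma>. \<gamma> \<in> extensional {0..1} \<and> continuous_map (top_of_set {0..1}) Y \<gamma> \<and> \<gamma> 0 = y0 \<and> \<gamma> 1 = y0}"
  by (auto simp: loop_topology_def topspace_path_topology)

text \<open>A path in the power from the basepoint to \<open>(h x, y0, ..., y0)\<close> is the same
  as a path in \<open>Y\<close> from \<open>y0\<close> to \<open>h x\<close> together with
  \<open>r - 1\<close> loops, so the equivalence is even a homeomorphism. Loop factor
  \<open>i\<close> is coordinate \<open>Suc i\<close>, which accounts for the shifts in
  \<open>u\<close> and \<open>p\<close>.\<close>

lemma homotopy_fibre_coord_map:
  fixes X :: "'a topology" and Y :: "'b topology" and h :: "'a \<Rightarrow> 'b"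
  assumes r: "r \<ge> 1" and h: "pointed_map X x0 Y y0 h" and x0: "x0 \<in> topspace X"
  shows "pointed_homotopy_equivalent
      (homotopy_fibre X (power_space Y r) (power_pt y0 r) (coord_map y0 r h 1))
      (x0, const_path (power_pt y0 r))
      (prod_topology (homotopy_fibre X Y y0 h)
         (product_topology (\<lambda>_. loop_topology Y y0) {1..r - 1}))
      ((x0, const_path y0), (\<lambda>i\<in>{1..r - 1}. const_path y0))"
proof -
  let ?I = "top_of_set {0..1::real}"
  let ?F = "homotopy_fibre X (power_space Y r) (power_pt y0 r) (coord_map y0 r h 1)"
  let ?L = "product_topology (\<lambda>_::nat. loop_topology Y y0) {1..r - 1}"
  let ?G = "prod_topology (homotopy_fibre X Y y0 h) ?L"
  have y0: "y0 \<in> topspace Y" using h x0 by (auto simp: pointed_map_def continuous_map_def)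
  have FP: "\<And>z. z \<in> topspace ?F \<Longrightarrow> snd z 0 = power_pt y0 r \<and> snd z 1 = coord_map y0 r h 1 (fst z)"
    by (auto simp: topspace_homotopy_fibre)
  define q where "q j w = snd (fst w) (clamp01 (snd w)) j" for j :: nat and w :: "('a \<times> (real \<Rightarrow> nat \<Rightarrow> 'b)) \<times> real"
  have "continuous_map (prod_topology ?F ?I) (power_space Y r) (\<lambda>w. snd (fst w) (clamp01 (snd w)))"
    by (rule continuous_map_path_apply[OF continuous_map_fibre_path[OF continuous_map_fst'[OF continuous_map_ident]]
       continuous_map_realI[OF continuous_map_snd]])
  then have q: "continuous_map (prod_topology ?F ?I) Y (q j)" if "j \<in> {1..r}" for j
    using continuous_map_product_apply[of _ "\<lambda>_. Y" "{1..r}" _ j] that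
    unfolding q_def[abs_def] power_space_def by blast
  define u where "u z = ((fst z, \<lambda>t\<in>{0..1}. q 1 (z, t)), \<lambda>i\<in>{1..r - 1}. \<lambda>t\<in>{0..1}. q (Suc i) (z, t))" for z
  have "continuous_map ?F ?G u"
    unfolding u_def[abs_def]
  proof (intro continuous_map_pairedI continuous_map_into_product)
    show "continuous_map ?F (homotopy_fibre X Y y0 h) (\<lambda>z. (fst z, \<lambda>t\<in>{0..1}. q 1 (z, t)))"
      using r by (intro continuous_map_into_fibre continuous_map_fibre_base[OF continuous_map_ident] q)
        (auto simp: q_def FP power_pt_def coord_map_def)
    fix i assume "i \<in> {1..r - 1}"
    then show "continuous_map ?F (loop_topology Y y0) (\<lambda>z. \<lambda>t\<in>{0..1}. q (Suc i) (z, t))"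
      by (intro continuous_map_into_loop q) (auto simp: q_def FP power_pt_def coord_map_def)
  qed
  then have u: "pointed_map ?F (x0, const_path (power_pt y0 r)) ?G
      ((x0, const_path y0), (\<lambda>i\<in>{1..r - 1}. const_path y0)) u"
    using r by (auto simp: pointed_map_def u_def q_def const_path_def power_pt_def fun_eq_iff)
  define p where "p j w = (if j = 1 then snd (fst (fst w)) (clamp01 (snd w)) else snd (fst w) (j - 1) (clamp01 (snd w)))"
    for j :: nat and w :: "(('a \<times> (real \<Rightarrow> 'b)) \<times> (nat \<Rightarrow> real \<Rightarrow> 'b)) \<times> real"
  have p: "continuous_map (prod_topology ?G ?I) Y (p j)" if "j \<in> {1..r}" for j
  proof (cases "j = 1")
    case True
    have "continuous_map (prod_topology ?G ?I) Y (\<lambda>w. snd (fst (fst w)) (clamp01 (snd w)))"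
      by (rule continuous_map_path_apply[OF continuous_map_fibre_path[OF continuous_map_fst'[OF continuous_map_fst'[OF continuous_map_ident]]]
       continuous_map_realI[OF continuous_map_snd]])
    then show ?thesis using True by (simp add: p_def[abs_def])
  next
    case False
    have "continuous_map (prod_topology ?G ?I) (loop_topology Y y0) (\<lambda>w. snd (fst w) (j - 1))"
      by (rule continuous_map_product_apply[OF continuous_map_snd'[OF continuous_map_fst'[OF continuous_map_ident]]])
        (use that False in auto)
    then have "continuous_map (prod_topology ?G ?I) Y (\<lambda>w. snd (fst w) (j - 1) (clamp01 (snd w)))"
      by (rule continuous_map_path_apply[OF continuous_map_loop_path continuous_map_realI[OF continuous_map_snd]])
    then show ?thesis using False by (simp add: p_def[abs_def])
  qed
  have pp: "continuous_map (prod_topology ?G ?I) (power_space Y r) (\<lambda>w. \<lambda>j\<in>{1..r}. p j w)"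
    unfolding power_space_def by (intro continuous_map_into_product p)
  have GL: "snd z i \<in> extensional {0..1} \<and> snd z i 0 = y0 \<and> snd z i 1 = y0"
    if "z \<in> topspace ?G" "i \<in> {1..r - 1}" for z i
    using that by (force simp: topspace_loop_topology PiE_iff)
  define v where "v z = (fst (fst z), \<lambda>t\<in>{0..1}. \<lambda>j\<in>{1..r}. p j (z, t))" for z
  have "continuous_map ?G ?F v"
    unfolding v_def[abs_def]
  proof (rule continuous_map_into_fibre[where q = "\<lambda>w. \<lambda>j\<in>{1..r}. p j w"])
    show "continuous_map ?G X (\<lambda>z. fst (fst z))"
      by (rule continuous_map_fibre_base[OF continuous_map_fst'[OF continuous_map_ident]])
    show "continuous_map (prod_topology ?G ?I) (power_space Y r) (\<lambda>w. \<lambda>j\<in>{1..r}. p j w)"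
      by (rule pp)
    fix z assume z: "z \<in> topspace ?G"
    then have z1: "fst z \<in> topspace (homotopy_fibre X Y y0 h)" by (simp add: mem_Times_iff)
    have GL': "snd z (j - 1) 0 = y0" "snd z (j - 1) 1 = y0" if "1 \<le> j" "j \<noteq> 1" "j \<le> r" for j
    proof -
      have "j - 1 \<in> {1..r - 1}" using that by simp arith
      then show "snd z (j - 1) 0 = y0" "snd z (j - 1) 1 = y0" using GL[OF z] by blast+
    qed
    show "(\<lambda>j\<in>{1..r}. p j (z, 0)) = power_pt y0 r"
      using z1 GL' by (auto simp: p_def power_pt_def topspace_homotopy_fibre intro!: restrict_ext)
    show "(\<lambda>j\<in>{1..r}. p j (z, 1)) = coord_map y0 r h 1 (fst (fst z))"
      using z1 GL' by (auto simp: p_def coord_map_def topspace_homotopy_fibre intro!: restrict_ext)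
  qed
  moreover have "v ((x0, const_path y0), (\<lambda>i\<in>{1..r - 1}. const_path y0)) = (x0, const_path (power_pt y0 r))"
    by (auto simp: v_def p_def const_path_def power_pt_def intro!: restrict_ext)
  ultimately have v: "pointed_map ?G ((x0, const_path y0), (\<lambda>i\<in>{1..r - 1}. const_path y0))
      ?F (x0, const_path (power_pt y0 r)) v"
    by (simp add: pointed_map_def)
  have bF: "(x0, const_path (power_pt y0 r)) \<in> topspace ?F"
  proof (rule basepoint_in_fibre[OF _ x0])
    show "pointed_map X x0 (power_space Y r) (power_pt y0 r) (coord_map y0 r h 1)"
      using h y0 unfolding pointed_map_def power_space_def coord_map_def[abs_def]
      by (auto simp: power_pt_def intro!: continuous_map_into_product)
  qed
  show ?thesis
  proof (rule pointed_homotopy_equivalentI_homeo[OF u v bF])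
    show "((x0, const_path y0), (\<lambda>i\<in>{1..r - 1}. const_path y0)) \<in> topspace ?G"
      by (rule pointed_map_basepoint[OF u bF])
  next
    fix z assume z: "z \<in> topspace ?F"
    obtain x \<gamma> where ze: "z = (x, \<gamma>)" by force
    have \<gamma>: "\<gamma> \<in> extensional {0..1}" "continuous_map ?I (power_space Y r) \<gamma>"
      using z by (auto simp: ze topspace_homotopy_fibre)
    \<comment> \<open>Points of the product are \<open>undefined\<close> off the index set, so the
      coordinates in \<open>{1..r}\<close> determine \<open>\<gamma> t\<close>.\<close>
    have \<gamma>e: "\<gamma> t \<in> extensional {1..r}" if "t \<in> {0..1}" for t
      using \<gamma>(2) that by (force simp: continuous_map_def power_space_def PiE_iff)
    have "(\<lambda>j\<in>{1..r}. p j (u z, t)) = \<gamma> t" if t: "t \<in> {0..1}" for t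
    proof
      fix j show "(\<lambda>j\<in>{1..r}. p j (u z, t)) j = \<gamma> t j"
        using t \<gamma>e[OF t] by (auto simp: p_def u_def q_def ze extensional_def)
    qed
    then have "(\<lambda>t\<in>{0..1}. \<lambda>j\<in>{1..r}. p j (u z, t)) = \<gamma>"
      using \<gamma>(1) by (auto simp: extensional_def fun_eq_iff)
    then show "v (u z) = z"
      by (simp add: v_def) (simp add: u_def ze)
  next
    fix z assume z: "z \<in> topspace ?G"
    obtain x \<alpha> \<beta> where ze: "z = ((x, \<alpha>), \<beta>)" by (metis prod.collapse)
    have \<alpha>: "\<alpha> \<in> extensional {0..1}" and \<beta>: "\<beta> \<in> extensional {1..r - 1}"
      using z by (auto simp: ze topspace_homotopy_fibre PiE_iff)
    have \<beta>e: "\<beta> i \<in> extensional {0..1}" if "i \<in> {1..r - 1}" for i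
      using GL[OF z that] by (simp add: ze)
    have "(\<lambda>t\<in>{0..1}. q 1 (v z, t)) = \<alpha>"
      using \<alpha> r by (auto simp: q_def v_def p_def ze extensional_def fun_eq_iff)
    moreover have "(\<lambda>t\<in>{0..1}. q (Suc i) (v z, t)) = \<beta> i" if i: "i \<in> {1..r - 1}" for i
    proof
      fix t show "(\<lambda>t\<in>{0..1}. q (Suc i) (v z, t)) t = \<beta> i t"
        using \<beta>e[OF i] i by (auto simp: q_def v_def p_def ze extensional_def)
    qed
    then have "(\<lambda>i\<in>{1..r - 1}. \<lambda>t\<in>{0..1}. q (Suc i) (v z, t)) = \<beta>"
      using \<beta> by (auto simp: extensional_def fun_eq_iff)
    ultimately show "u (v z) = z"
      by (simp add: u_def) (simp add: v_def ze)
  qed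
qed

section \<open>The abelian group of pointed homotopy classes\<close>

lemma pointed_map_const: "w0 \<in> topspace W \<Longrightarrow> pointed_map Z z0 W w0 (\<lambda>_. w0)"
  by (simp add: pointed_map_def)

text \<open>A function that is not a pointed map has the empty class, and two such functions have
  equal classes without being homotopic; hence the assumption on \<open>a\<close>.\<close>

lemma htpy_class_eq_iff:
  assumes "pointed_map X x0 W w0 a"
  shows "htpy_class X x0 W w0 a = htpy_class X x0 W w0 b \<longleftrightarrow> pointed_homotopic X x0 W w0 a b"
  unfolding htpy_class_def
  by (auto intro: pointed_homotopic_sym pointed_homotopic_trans)
    (metis assms mem_Collect_eq pointed_homotopic_refl pointed_homotopic_sym)

lemma htpy_class_in_carrier:
  "pointed_map X x0 W w0 a \<Longrightarrow> htpy_class X x0 W w0 a \<in> carrier (htpy_group X x0 W w0 mul)"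
  by (simp add: htpy_group_def)

lemma in_carrier_htpy_group:
  assumes "A \<in> carrier (htpy_group X x0 W w0 mul)"
  obtains a where "pointed_map X x0 W w0 a" "A = htpy_class X x0 W w0 a"
  using assms by (auto simp: htpy_group_def)

lemma one_htpy_group: "\<one>\<^bsub>htpy_group X x0 W w0 mul\<^esub> = htpy_class X x0 W w0 (\<lambda>_. w0)"
  by (simp add: htpy_group_def)

text \<open>Stated for a general \<open>W\<close> since it is used twice: for \<open>Y\<close>, and
  for the power of \<open>Y\<close> with its coordinatewise structure.\<close>

locale abelian_H_group =
  fixes W :: "'w topology" and w0 :: 'w and mul :: "'w \<times> 'w \<Rightarrow> 'w" and neg :: "'w \<Rightarrow> 'w"
  assumes H_group: "H_group W w0 mul neg" and commutative: "homotopy_commutative W w0 mul"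
begin

lemma H_space: "H_space W w0 mul" and
  mul: "pointed_map (prod_topology W W) (w0, w0) W w0 mul" and
  neg: "pointed_map W w0 W w0 neg" and
  w0: "w0 \<in> topspace W"
  using H_group by (auto simp: H_group_def H_space_def)

lemma pointed_map_mul:
  assumes "pointed_map X x0 W w0 a" "pointed_map X x0 W w0 b"
  shows "pointed_map X x0 W w0 (\<lambda>x. mul (a x, b x))"
proof -
  have "pointed_map X x0 (prod_topology W W) (w0, w0) (\<lambda>x. (a x, b x))"
    using assms by (auto simp: pointed_map_def intro: continuous_map_pairedI)
  from pointed_map_compose[OF this mul] show ?thesis by (simp add: o_def)
qed

lemma pointed_map_neg:
  "pointed_map X x0 W w0 a \<Longrightarrow> pointed_map X x0 W w0 (\<lambda>x. neg (a x))"
  using pointed_map_compose[OF _ neg, of X x0 a] by (simp add: o_def)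

lemma pointed_homotopic_mul:
  assumes "pointed_homotopic X x0 W w0 a a'" "pointed_homotopic X x0 W w0 b b'"
  shows "pointed_homotopic X x0 W w0 (\<lambda>x. mul (a x, b x)) (\<lambda>x. mul (a' x, b' x))"
proof -
  obtain h where h: "continuous_map (prod_topology (top_of_set {0..1::real}) X) W h"
    "\<And>x. h (0, x) = a x" "\<And>x. h (1, x) = a' x" "\<And>t. t \<in> {0..1} \<Longrightarrow> h (t, x0) = w0"
    using assms(1) unfolding pointed_homotopic_def homotopic_with_def by blast
  obtain k where k: "continuous_map (prod_topology (top_of_set {0..1::real}) X) W k"
    "\<And>x. k (0, x) = b x" "\<And>x. k (1, x) = b' x" "\<And>t. t \<in> {0..1} \<Longrightarrow> k (t, x0) = w0"
    using assms(2) unfolding pointed_homotopic_def homotopic_with_def by blast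
  have "continuous_map (prod_topology (top_of_set {0..1::real}) X) W (\<lambda>p. mul (h p, k p))"
    using continuous_map_compose[OF continuous_map_pairedI[OF h(1) k(1)], of W mul] mul
    by (simp add: o_def pointed_map_def)
  moreover have "mul (w0, w0) = w0" using mul by (simp add: pointed_map_def)
  ultimately show ?thesis
    unfolding pointed_homotopic_def homotopic_with_def
    by (intro exI[of _ "\<lambda>p. mul (h p, k p)"]) (simp add: h k)
qed

lemma pointed_homotopic_mul_assoc:
  assumes "pointed_map X x0 W w0 a" "pointed_map X x0 W w0 b" "pointed_map X x0 W w0 c"
  shows "pointed_homotopic X x0 W w0 (\<lambda>x. mul (mul (a x, b x), c x)) (\<lambda>x. mul (a x, mul (b x, c x)))"
proof -
  have "pointed_map X x0 (prod_topology (prod_topology W W) W) ((w0, w0), w0) (\<lambda>x. ((a x, b x), c x))"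
    using assms by (auto simp: pointed_map_def intro!: continuous_map_pairedI)
  from pointed_homotopic_compose_right[OF _ this] H_group show ?thesis
    by (fastforce simp: H_group_def o_def)
qed

lemma pointed_homotopic_mul_commute:
  assumes "pointed_map X x0 W w0 a" "pointed_map X x0 W w0 b"
  shows "pointed_homotopic X x0 W w0 (\<lambda>x. mul (a x, b x)) (\<lambda>x. mul (b x, a x))"
proof -
  have "pointed_map X x0 (prod_topology W W) (w0, w0) (\<lambda>x. (a x, b x))"
    using assms by (auto simp: pointed_map_def intro!: continuous_map_pairedI)
  from pointed_homotopic_compose_right[OF _ this] commutative show ?thesis
    by (fastforce simp: homotopy_commutative_def o_def)
qed

lemma pointed_homotopic_mul_unit:
  assumes "pointed_map X x0 W w0 a"
  shows "pointed_homotopic X x0 W w0 (\<lambda>x. mul (a x, w0)) a" "pointed_homotopic X x0 W w0 (\<lambda>x. mul (w0, a x)) a"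
  using pointed_homotopic_compose_right[OF _ assms] H_space
  by (fastforce simp: H_space_def o_def)+

lemma pointed_homotopic_mul_neg:
  assumes "pointed_map X x0 W w0 a"
  shows "pointed_homotopic X x0 W w0 (\<lambda>x. mul (a x, neg (a x))) (\<lambda>x. w0)"
    "pointed_homotopic X x0 W w0 (\<lambda>x. mul (neg (a x), a x)) (\<lambda>x. w0)"
  using pointed_homotopic_compose_right[OF _ assms] H_group
  by (fastforce simp: H_group_def o_def)+

text \<open>The union in the definition of the product runs over all representatives; since
  multiplication respects homotopy, every set in it is the same class.\<close>

lemma mult_htpy_class:
  assumes "pointed_map X x0 W w0 a" "pointed_map X x0 W w0 b"
  shows "htpy_class X x0 W w0 a \<otimes>\<^bsub>htpy_group X x0 W w0 mul\<^esub> htpy_class X x0 W w0 b =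
    htpy_class X x0 W w0 (\<lambda>x. mul (a x, b x))"
proof -
  have "htpy_class X x0 W w0 (\<lambda>x. mul (a' x, b' x)) = htpy_class X x0 W w0 (\<lambda>x. mul (a x, b x))"
    if "a' \<in> htpy_class X x0 W w0 a" "b' \<in> htpy_class X x0 W w0 b" for a' b'
    using that pointed_homotopic_mul[of X x0 a a' b b'] htpy_class_eq_iff[OF pointed_map_mul[OF assms]]
    by (auto simp: htpy_class_def)
  moreover have "a \<in> htpy_class X x0 W w0 a" "b \<in> htpy_class X x0 W w0 b"
    using assms by (auto simp: htpy_class_def pointed_homotopic_refl)
  ultimately have "(\<Union>a'\<in>htpy_class X x0 W w0 a. \<Union>b'\<in>htpy_class X x0 W w0 b. 
      htpy_class X x0 W w0 (\<lambda>x. mul (a' x, b' x))) = htpy_class X x0 W w0 (\<lambda>x. mul (a x, b x))"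
    by blast
  then show ?thesis by (simp add: htpy_group_def)
qed

lemma comm_group_htpy_group: "comm_group (htpy_group X x0 W w0 mul)"
proof (rule comm_groupI)
  let ?G = "htpy_group X x0 W w0 mul"
  note pm = pointed_map_mul pointed_map_neg pointed_map_const[OF w0]
  fix A B assume "A \<in> carrier ?G" "B \<in> carrier ?G"
  then obtain a b where a: "pointed_map X x0 W w0 a" "A = htpy_class X x0 W w0 a"
    and b: "pointed_map X x0 W w0 b" "B = htpy_class X x0 W w0 b"
    by (metis in_carrier_htpy_group)
  show "A \<otimes>\<^bsub>?G\<^esub> B \<in> carrier ?G"
    by (simp add: a b mult_htpy_class htpy_class_in_carrier pm)
  show "A \<otimes>\<^bsub>?G\<^esub> B = B \<otimes>\<^bsub>?G\<^esub> A"
    by (simp add: a b mult_htpy_class htpy_class_eq_iff pm pointed_homotopic_mul_commute)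
  show "\<one>\<^bsub>?G\<^esub> \<otimes>\<^bsub>?G\<^esub> A = A"
    by (simp add: a one_htpy_group mult_htpy_class htpy_class_eq_iff pm pointed_homotopic_mul_unit)
  show "\<exists>C\<in>carrier ?G. C \<otimes>\<^bsub>?G\<^esub> A = \<one>\<^bsub>?G\<^esub>"
    by (rule bexI[of _ "htpy_class X x0 W w0 (\<lambda>x. neg (a x))"])
      (simp_all add: a one_htpy_group mult_htpy_class htpy_class_in_carrier htpy_class_eq_iff pm pointed_homotopic_mul_neg)
  fix C assume "C \<in> carrier ?G"
  then obtain c where c: "pointed_map X x0 W w0 c" "C = htpy_class X x0 W w0 c"
    by (metis in_carrier_htpy_group)
  show "A \<otimes>\<^bsub>?G\<^esub> B \<otimes>\<^bsub>?G\<^esub> C = A \<otimes>\<^bsub>?G\<^esub> (B \<otimes>\<^bsub>?G\<^esub> C)"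
    by (simp add: a b c mult_htpy_class htpy_class_eq_iff pm pointed_homotopic_mul_assoc)
qed (simp add: one_htpy_group htpy_class_in_carrier pointed_map_const w0)

lemma group_htpy_group: "group (htpy_group X x0 W w0 mul)"
  using comm_group_htpy_group by (rule comm_group.axioms(2))

lemma inv_htpy_class:
  assumes a: "pointed_map X x0 W w0 a"
  shows "inv\<^bsub>htpy_group X x0 W w0 mul\<^esub> htpy_class X x0 W w0 a = htpy_class X x0 W w0 (\<lambda>x. neg (a x))"
  by (rule group.inv_equality[OF group_htpy_group])
    (simp_all add: a mult_htpy_class one_htpy_group pointed_map_neg pointed_map_mul htpy_class_eq_iff
      pointed_homotopic_mul_neg htpy_class_in_carrier)

lemma pointed_map_nat_power:
  "pointed_map X x0 W w0 a \<Longrightarrow> pointed_map X x0 W w0 (\<lambda>x. nat_power_map mul w0 n (a x))"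
  by (induction n) (simp_all add: pointed_map_const w0 pointed_map_mul)

lemma pointed_map_power:
  "pointed_map X x0 W w0 a \<Longrightarrow> pointed_map X x0 W w0 (\<lambda>x. power_map mul neg w0 k (a x))"
  by (cases "k \<ge> 0") (simp_all add: power_map_def pointed_map_nat_power pointed_map_neg)

lemma htpy_class_nat_power:
  assumes a: "pointed_map X x0 W w0 a"
  shows "htpy_class X x0 W w0 (\<lambda>x. nat_power_map mul w0 n (a x)) =
    htpy_class X x0 W w0 a [^]\<^bsub>htpy_group X x0 W w0 mul\<^esub> n"
  by (induction n)
    (simp_all add: one_htpy_group mult_htpy_class[symmetric] pointed_map_nat_power a)

lemma htpy_class_power:
  assumes a: "pointed_map X x0 W w0 a"
  shows "htpy_class X x0 W w0 (\<lambda>x. power_map mul neg w0 k (a x)) =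
    htpy_class X x0 W w0 a [^]\<^bsub>htpy_group X x0 W w0 mul\<^esub> k"
  by (simp add: power_map_def int_pow_def2 htpy_class_nat_power[OF a, symmetric] inv_htpy_class
      pointed_map_nat_power[OF a])

text \<open>Infinite order is encoded as 0, and \<open>0 dvd l - k\<close> means
  \<open>l = k\<close>; both cases are thus covered by one divisibility.\<close>

lemma map_order_dvd_iff:
  fixes k l :: int
  assumes a: "pointed_map X x0 W w0 a"
  shows "htpy_class X x0 W w0 a [^]\<^bsub>htpy_group X x0 W w0 mul\<^esub> k =
      htpy_class X x0 W w0 a [^]\<^bsub>htpy_group X x0 W w0 mul\<^esub> l \<longleftrightarrow>
    int (map_order X x0 W w0 mul a) dvd l - k"
  unfolding map_order_def
  by (rule group.int_pow_eq[OF group_htpy_group htpy_class_in_carrier[OF a]])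

end

section \<open>Maps into powers\<close>

lemma pointed_map_power_space_iff:
  "pointed_map Z z0 (power_space Y r) (power_pt y0 r) (\<lambda>z. \<lambda>j\<in>{1..r}. a j z) \<longleftrightarrow>
     (\<forall>j\<in>{1..r}. pointed_map Z z0 Y y0 (a j))"
proof -
  have "(\<lambda>j\<in>{1..r}. a j z0) = (\<lambda>j\<in>{1..r}. y0) \<longleftrightarrow> (\<forall>j\<in>{1..r}. a j z0 = y0)"
    by (force simp: fun_eq_iff)
  moreover have "continuous_map Z (power_space Y r) (\<lambda>z. \<lambda>j\<in>{1..r}. a j z) \<longleftrightarrow>
      (\<forall>j\<in>{1..r}. continuous_map Z Y (a j))"
    by (auto simp: power_space_def continuous_map_componentwise)
  ultimately show ?thesis
    unfolding pointed_map_def power_pt_def by blast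
qed

lemma pointed_map_proj:
  assumes "pointed_map Z z0 (power_space Y r) (power_pt y0 r) a" "j \<in> {1..r}"
  shows "pointed_map Z z0 Y y0 (\<lambda>z. a z j)"
  using assms by (auto simp: pointed_map_def power_space_def power_pt_def continuous_map_componentwise)

lemma pointed_homotopic_proj:
  assumes "pointed_homotopic Z z0 (power_space Y r) (power_pt y0 r) a b" "j \<in> {1..r}"
  shows "pointed_homotopic Z z0 Y y0 (\<lambda>z. a z j) (\<lambda>z. b z j)"
proof -
  have "pointed_map (power_space Y r) (power_pt y0 r) Y y0 (\<lambda>y. y j)"
    using assms(2) by (auto simp: pointed_map_def power_space_def power_pt_def intro: continuous_map_product_projection)
  from pointed_homotopic_compose_left[OF assms(1) this] show ?thesis by (simp add: o_def)
qed

text \<open>Choosing a homotopy in every coordinate gives one into the product. Together with the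
  projections this makes classes of maps into the power the same as tuples of classes.\<close>

lemma pointed_homotopic_power_spaceI:
  assumes z0: "z0 \<in> topspace Z"
    and a: "pointed_map Z z0 (power_space Y r) (power_pt y0 r) a"
    and b: "pointed_map Z z0 (power_space Y r) (power_pt y0 r) b"
    and ab: "\<And>j. j \<in> {1..r} \<Longrightarrow> pointed_homotopic Z z0 Y y0 (\<lambda>z. a z j) (\<lambda>z. b z j)"
  shows "pointed_homotopic Z z0 (power_space Y r) (power_pt y0 r) a b"
proof -
  have ext: "f z = (\<lambda>j\<in>{1..r}. f z j)"
    if "pointed_map Z z0 (power_space Y r) (power_pt y0 r) f" "z \<in> topspace Z" for f z
  proof -
    have "f z \<in> extensional {1..r}"
      using that by (auto simp: pointed_map_def power_space_def continuous_map_componentwise)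
    then show ?thesis by (simp add: extensional_restrict)
  qed
  have "\<exists>h. \<forall>j\<in>{1..r}. continuous_map (prod_topology (top_of_set {0..1::real}) Z) Y (h j) \<and>
     (\<forall>z. h j (0, z) = a z j) \<and> (\<forall>z. h j (1, z) = b z j) \<and> (\<forall>t\<in>{0..1}. h j (t, z0) = y0)"
    by (rule bchoice) (use ab in \<open>simp add: pointed_homotopic_def homotopic_with_def\<close>)
  then obtain h where h: "\<And>j. j \<in> {1..r} \<Longrightarrow> continuous_map (prod_topology (top_of_set {0..1::real}) Z) Y (h j)"
    "\<And>j z. j \<in> {1..r} \<Longrightarrow> h j (0, z) = a z j" "\<And>j z. j \<in> {1..r} \<Longrightarrow> h j (1, z) = b z j"
    "\<And>j t. j \<in> {1..r} \<Longrightarrow> t \<in> {0..1} \<Longrightarrow> h j (t, z0) = y0"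
    by blast
  have hom: "pointed_homotopic Z z0 (power_space Y r) (power_pt y0 r)
     (\<lambda>z. \<lambda>j\<in>{1..r}. a z j) (\<lambda>z. \<lambda>j\<in>{1..r}. b z j)"
    unfolding pointed_homotopic_def homotopic_with_def
  proof (intro exI[of _ "\<lambda>p. \<lambda>j\<in>{1..r}. h j p"] conjI allI ballI)
    show "continuous_map (prod_topology (top_of_set {0..1::real}) Z) (power_space Y r) (\<lambda>p. \<lambda>j\<in>{1..r}. h j p)"
      unfolding power_space_def by (intro continuous_map_into_product h)
  qed (use h in \<open>auto simp: power_pt_def intro!: restrict_ext\<close>)
  \<comment> \<open>Values of \<open>a\<close> are extensional only at points of \<open>Z\<close>,
    so \<open>a\<close> and its restricted form agree there and possibly nowhere else.\<close>
  have "pointed_homotopic Z z0 (power_space Y r) (power_pt y0 r) a (\<lambda>z. \<lambda>j\<in>{1..r}. a z j)"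
    by (rule pointed_homotopic_equal[OF a z0]) (rule ext[OF a])
  moreover have "pointed_homotopic Z z0 (power_space Y r) (power_pt y0 r) b (\<lambda>z. \<lambda>j\<in>{1..r}. b z j)"
    by (rule pointed_homotopic_equal[OF b z0]) (rule ext[OF b])
  ultimately show ?thesis
    using pointed_homotopic_trans[OF _ pointed_homotopic_trans[OF hom pointed_homotopic_sym]] by blast
qed

definition power_neg :: "('b \<Rightarrow> 'b) \<Rightarrow> nat \<Rightarrow> (nat \<Rightarrow> 'b) \<Rightarrow> nat \<Rightarrow> 'b" where
  "power_neg neg r = (\<lambda>a. \<lambda>j\<in>{1..r}. neg (a j))"

lemma power_mult_apply: "j \<in> {1..r} \<Longrightarrow> power_mult mul r p j = mul (fst p j, snd p j)"
  by (simp add: power_mult_def case_prod_beta)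

lemma power_neg_apply: "j \<in> {1..r} \<Longrightarrow> power_neg neg r a j = neg (a j)"
  by (simp add: power_neg_def)

lemma power_pt_apply: "j \<in> {1..r} \<Longrightarrow> power_pt y0 r j = y0"
  by (simp add: power_pt_def)

context abelian_H_group
begin

lemma pointed_map_power_mult:
  assumes "pointed_map Z z0 (power_space W r) (power_pt w0 r) a"
    "pointed_map Z z0 (power_space W r) (power_pt w0 r) b"
  shows "pointed_map Z z0 (power_space W r) (power_pt w0 r) (\<lambda>z. power_mult mul r (a z, b z))"
  unfolding power_mult_def prod.case pointed_map_power_space_iff
  using assms by (intro ballI pointed_map_mul) (auto intro: pointed_map_proj)

lemma pointed_map_power_neg:
  assumes "pointed_map Z z0 (power_space W r) (power_pt w0 r) a"
  shows "pointed_map Z z0 (power_space W r) (power_pt w0 r) (\<lambda>z. power_neg neg r (a z))"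
  unfolding power_neg_def pointed_map_power_space_iff
  using assms by (intro ballI pointed_map_neg) (auto intro: pointed_map_proj)

lemma power_pt_in_topspace: "power_pt w0 r \<in> topspace (power_space W r)"
  using w0 by (auto simp: power_pt_def power_space_def)

text \<open>Each law is checked in one coordinate at a time, where it is the law of \<open>W\<close>
  applied to projections from the power, its square or its cube.\<close>

lemma abelian_H_group_power_space:
  "abelian_H_group (power_space W r) (power_pt w0 r) (power_mult mul r) (power_neg neg r)"
proof
  let ?P = "power_space W r" and ?p = "power_pt w0 r"
  let ?PP = "prod_topology ?P ?P" and ?PPP = "prod_topology (prod_topology ?P ?P) ?P"
  note pt = power_pt_in_topspace
  have pm: "pointed_map ?P ?p ?P ?p (\<lambda>y. y)" "pointed_map ?P ?p ?P ?p id" 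
    "pointed_map ?P ?p ?P ?p (\<lambda>y. ?p)"
    "pointed_map ?PP (?p, ?p) ?P ?p (\<lambda>w. fst w)" "pointed_map ?PP (?p, ?p) ?P ?p (\<lambda>w. snd w)"
    "pointed_map ?PPP ((?p, ?p), ?p) ?P ?p (\<lambda>w. fst (fst w))"
    "pointed_map ?PPP ((?p, ?p), ?p) ?P ?p (\<lambda>w. snd (fst w))"
    "pointed_map ?PPP ((?p, ?p), ?p) ?P ?p (\<lambda>w. snd w)"
    using pt by (auto simp: pointed_map_def intro: continuous_map_fst' continuous_map_snd'
        continuous_map_fst continuous_map_snd)
  note pms = pm pointed_map_power_mult pointed_map_power_neg
  note simps = power_mult_apply power_neg_apply power_pt_apply
  note proj = pm[THEN pointed_map_proj]
  have "pointed_map ?PP (?p, ?p) ?P ?p (power_mult mul r)"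
    using pointed_map_power_mult[OF pm(4,5)] by simp
  moreover have "pointed_map ?P ?p ?P ?p (power_neg neg r)"
    using pointed_map_power_neg[OF pm(1)] by simp
  moreover have "pointed_homotopic ?P ?p ?P ?p (\<lambda>y. power_mult mul r (y, ?p)) id"
    "pointed_homotopic ?P ?p ?P ?p (\<lambda>y. power_mult mul r (?p, y)) id"
    by (intro pointed_homotopic_power_spaceI pms pt;
        simp add: simps pointed_homotopic_mul_unit proj)+
  moreover have "pointed_homotopic ?P ?p ?P ?p (\<lambda>y. power_mult mul r (y, power_neg neg r y)) (\<lambda>y. ?p)"
    "pointed_homotopic ?P ?p ?P ?p (\<lambda>y. power_mult mul r (power_neg neg r y, y)) (\<lambda>y. ?p)"
    by (intro pointed_homotopic_power_spaceI pms pt;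
        simp add: simps pointed_homotopic_mul_neg proj)+
  moreover have "pointed_homotopic ?PPP ((?p, ?p), ?p) ?P ?p
     (\<lambda>w. power_mult mul r (power_mult mul r (fst (fst w), snd (fst w)), snd w))
     (\<lambda>w. power_mult mul r (fst (fst w), power_mult mul r (snd (fst w), snd w)))"
    by (intro pointed_homotopic_power_spaceI pms)
      (simp_all add: simps pt pointed_homotopic_mul_assoc proj)
  moreover have "pointed_homotopic ?PP (?p, ?p) ?P ?p
     (\<lambda>w. power_mult mul r (fst w, snd w)) (\<lambda>w. power_mult mul r (snd w, fst w))"
    by (intro pointed_homotopic_power_spaceI pms)
      (simp_all add: simps pt pointed_homotopic_mul_commute proj)
  ultimately show "H_group ?P ?p (power_mult mul r) (power_neg neg r)"
    "homotopy_commutative ?P ?p (power_mult mul r)"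
    by (simp_all add: H_group_def H_space_def homotopy_commutative_def pt case_prod_beta' del: split_paired_All)
qed

end

section \<open>Euclid's algorithm by elementary operations\<close>

text \<open>\<open>R a b\<close> stands for equivalence of the fibres of the tuples with
  coefficients \<open>a\<close> and \<open>b\<close>. Congruence modulo \<open>m\<close> reflects
  that \<open>m\<close> kills the given map, and it also makes \<open>R\<close> reflexive.\<close>

context
  fixes R :: "(nat \<Rightarrow> int) \<Rightarrow> (nat \<Rightarrow> int) \<Rightarrow> bool" and m :: int and r :: nat
  assumes cong: "\<And>a b. \<forall>j\<in>{1..r}. m dvd a j - b j \<Longrightarrow> R a b"
    and sym: "\<And>a b. R a b \<Longrightarrow> R b a"
    and trans: "\<And>a b c. R a b \<Longrightarrow> R b c \<Longrightarrow> R a c"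
    and add: "\<And>a i j. i \<in> {1..r} \<Longrightarrow> j \<in> {1..r} \<Longrightarrow> i \<noteq> j \<Longrightarrow> R a (a(i := a i + a j))"
begin

text \<open>Adding entry \<open>j\<close> back undoes the subtraction, so symmetry of
  \<open>R\<close> suffices.\<close>

lemma reduce_diff:
  assumes "i \<in> {1..r}" "j \<in> {1..r}" "i \<noteq> j"
  shows "R a (a(i := a i - a j))"
  using sym[OF add[OF assms, of "a(i := a i - a j)"]] assms by simp

text \<open>Additions and subtractions have determinant one, so a lone sign change is not among
  their products; the zero entry gives the room for it. For a negative entry \<open>x\<close> the
  pair goes through \<open>(x, 0)\<close>, \<open>(x, -x)\<close>, \<open>(0, -x)\<close>,
  \<open>(-x, -x)\<close>, \<open>(-x, 0)\<close>.\<close>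

lemma reduce_abs:
  assumes ij: "i \<in> {1..r}" "j \<in> {1..r}" "i \<noteq> j" and "a j = 0"
  shows "R a (a(i := \<bar>a i\<bar>))"
proof (cases "a i \<ge> 0")
  case True
  then show ?thesis by (intro cong) auto
next
  case False
  note [trans] = trans
  define a1 where "a1 = a(j := a j - a i)"
  define a2 where "a2 = a1(i := a1 i + a1 j)"
  define a3 where "a3 = a2(i := a2 i + a2 j)"
  have "R a a1" unfolding a1_def using ij by (intro reduce_diff) auto
  also have "R a1 a2" unfolding a2_def using ij by (intro add) auto
  also have "R a2 a3" unfolding a3_def using ij by (intro add) auto
  also have "R a3 (a3(j := a3 j - a3 i))" using ij by (intro reduce_diff) auto
  also have "a3(j := a3 j - a3 i) = a(i := \<bar>a i\<bar>)"
    using ij False \<open>a j = 0\<close> by (auto simp: a3_def a2_def a1_def fun_eq_iff)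
  finally show ?thesis .
qed

text \<open>Subtractive Euclid: the entry of smaller absolute value is subtracted from or added to
  the other one, which keeps the gcd and lowers the sum of absolute values.\<close>

lemma reduce_gcd:
  assumes ij: "i \<in> {1..r}" "j \<in> {1..r}" "i \<noteq> j"
  shows "R a (a(i := gcd (a i) (a j), j := 0))"
proof (induction "nat (\<bar>a i\<bar> + \<bar>a j\<bar>)" arbitrary: a rule: less_induct)
  case less
  have step: ?case if "R a c" "nat (\<bar>c i\<bar> + \<bar>c j\<bar>) < nat (\<bar>a i\<bar> + \<bar>a j\<bar>)"
    "gcd (c i) (c j) = gcd (a i) (a j)" "\<And>l. l \<noteq> i \<Longrightarrow> l \<noteq> j \<Longrightarrow> c l = a l" for c
  proof -
    have "c(i := gcd (c i) (c j), j := 0) = a(i := gcd (a i) (a j), j := 0)"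
      using that by (auto simp: fun_eq_iff)
    then show ?thesis using trans[OF that(1) less[OF that(2)]] by simp
  qed
  consider "a j = 0" | "a i = 0" "a j \<noteq> 0" | "a i \<noteq> 0" "a j \<noteq> 0" "\<bar>a j\<bar> \<le> \<bar>a i\<bar>"
    | "a i \<noteq> 0" "a j \<noteq> 0" "\<bar>a i\<bar> < \<bar>a j\<bar>" by linarith
  then show ?case
  proof cases
    case 1
    then have "a(i := gcd (a i) (a j), j := 0) = a(i := \<bar>a i\<bar>)" by (auto simp: fun_eq_iff)
    then show ?thesis using reduce_abs[OF ij, of a] 1 by simp
  next
    case 2
    \<comment> \<open>The nonzero entry sits in the wrong place: it is copied to \<open>i\<close>,
      cleared at \<open>j\<close>, and then made nonnegative.\<close>
    define a1 where "a1 = a(i := a i + a j)"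
    define a2 where "a2 = a1(j := a1 j - a1 i)"
    have "R a a1" unfolding a1_def using ij by (intro add) auto
    moreover have "R a1 a2" unfolding a2_def using ij by (intro reduce_diff) auto
    moreover have "R a2 (a2(i := \<bar>a2 i\<bar>))"
      using ij 2 by (intro reduce_abs) (auto simp: a2_def a1_def)
    moreover have "a2(i := \<bar>a2 i\<bar>) = a(i := gcd (a i) (a j), j := 0)"
      using ij 2 by (auto simp: a2_def a1_def fun_eq_iff)
    ultimately show ?thesis by (metis trans)
  next
    case 3
    \<comment> \<open>With equal signs a difference reduces the absolute value, with opposite signs
      a sum does.\<close>
    show ?thesis
    proof (cases "(a i \<ge> 0) = (a j \<ge> 0)")
      case True
      show ?thesis
        using ij 3 True by (intro step[OF reduce_diff[OF ij, of a]]) (auto simp: gcd_diff1)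
    next
      case False
      show ?thesis
        using ij 3 False by (intro step[OF add[OF ij, of a]]) auto
    qed
  next
    case 4
    have ji: "j \<in> {1..r}" "i \<in> {1..r}" "j \<noteq> i" using ij by auto
    show ?thesis
    proof (cases "(a i \<ge> 0) = (a j \<ge> 0)")
      case True
      show ?thesis
        using ij 4 True by (intro step[OF reduce_diff[OF ji, of a]])
          (auto simp: gcd_diff1 gcd.commute[of "a i"])
    next
      case False
      show ?thesis
        using ij 4 False by (intro step[OF add[OF ji, of a]]) (auto simp: gcd.commute[of "a i"])
    qed
  qed
qed

lemma reduce_Gcd:
  assumes r: "r \<ge> 2"
  shows "R a (\<lambda>j. if j = 1 then Gcd (insert m (a ` {1..r})) else 0)"
proof -
  \<comment> \<open>The tuple after entries 2 to \<open>n\<close> have been swept into the first.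
    The induction starts at \<open>n = 2\<close>, since for \<open>n = 1\<close> the
    \<open>Gcd\<close> would be the absolute value of \<open>a 1\<close> and already need a sign
    change.\<close>
  let ?b = "\<lambda>n l. if l = 1 then Gcd (a ` {1..n}) else if l \<in> {1..n} then 0 else a l"
  have "R a (?b n)" if "2 \<le> n" "n \<le> r" for n
    using that
  proof (induction n rule: nat_induct_at_least)
    case base
    have "{1..2} = {1, 2 :: nat}" by auto
    then have "?b 2 = a(1 := gcd (a 1) (a 2), 2 := 0)"
      by (auto simp: fun_eq_iff)
    then show ?case using reduce_gcd[of 1 2 a] r by simp
  next
    case (Suc n)
    have eq: "{Suc 0..Suc n} = insert (Suc n) {Suc 0..n}" by auto
    have "?b (Suc n) = (?b n)(1 := gcd (?b n 1) (?b n (Suc n)), Suc n := 0)"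
      using Suc.hyps by (auto simp: fun_eq_iff eq gcd.commute)
    then show ?case
      using trans[OF Suc.IH reduce_gcd[of 1 "Suc n" "?b n"]] Suc.prems Suc.hyps by simp
  qed
  then have 1: "R a (?b r)" using r by blast
  \<comment> \<open>the entry \<open>m\<close> in the second place is congruent to \<open>0\<close>\<close>
  define c :: "nat \<Rightarrow> int" where "c = (\<lambda>l. if l = 1 then Gcd (a ` {1..r}) else if l = 2 then m else 0)"
  have "R (?b r) c"
    unfolding c_def using r by (intro cong) auto
  moreover have "R c (c(1 := gcd (c 1) (c 2), 2 := 0))"
    using r by (intro reduce_gcd) auto
  moreover have "c(1 := gcd (c 1) (c 2), 2 := 0) = (\<lambda>j. if j = 1 then Gcd (insert m (a ` {1..r})) else 0)"
    by (auto simp: c_def fun_eq_iff gcd.commute)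
  ultimately show ?thesis using 1 by (metis (no_types, lifting) trans)
qed

end

text \<open>The condition does not involve \<open>x\<close>; it is meant for tuples in which one
  coordinate is treated separately.\<close>

lemma pointed_map_if:
  "(P \<Longrightarrow> pointed_map X x0 Y y0 a) \<Longrightarrow> (\<not> P \<Longrightarrow> pointed_map X x0 Y y0 b) \<Longrightarrow>
    pointed_map X x0 Y y0 (\<lambda>x. if P then a x else b x)"
  by (cases P) simp_all

section \<open>Tuples of multiples of a map\<close>

locale map_to_abelian_H_group = abelian_H_group W w0 mul neg
  for W :: "'w topology" and w0 mul neg +
  fixes X :: "'x topology" and x0 :: 'x and f :: "'x \<Rightarrow> 'w" and r :: nat
  assumes f: "pointed_map X x0 W w0 f" and x0: "x0 \<in> topspace X"
begin

abbreviation WG where "WG \<equiv> htpy_group X x0 W w0 mul"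
abbreviation PG where "PG \<equiv> power_htpy_group X x0 W w0 mul r"
abbreviation cls where "cls \<equiv> htpy_class X x0 W w0"
abbreviation pcls where "pcls \<equiv> power_htpy_class X x0 W w0 r"
abbreviation pmap where "pmap \<equiv> pointed_map X x0 (power_space W r) (power_pt w0 r)"
abbreviation fib where "fib g \<equiv> homotopy_fibre X (power_space W r) (power_pt w0 r) g"

text \<open>Explicit representatives for the elements of the subgroup generated by the coordinate
  maps. Coefficients outside \<open>{1..r}\<close> have no effect.\<close>

definition multiples :: "(nat \<Rightarrow> int) \<Rightarrow> 'x \<Rightarrow> nat \<Rightarrow> 'w" where
  "multiples a = (\<lambda>x. \<lambda>j\<in>{1..r}. power_map mul neg w0 (a j) (f x))"

interpretation P: abelian_H_group "power_space W r" "power_pt w0 r" "power_mult mul r" "power_neg neg r"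
  by (rule abelian_H_group_power_space)

interpretation WG: comm_group WG by (rule comm_group_htpy_group)
interpretation PG: comm_group PG by (rule P.comm_group_htpy_group)

lemma pmap_multiples: "pmap (multiples a)"
  unfolding multiples_def pointed_map_power_space_iff by (intro ballI pointed_map_power f)

lemma cls_f: "cls f \<in> carrier WG"
  by (rule htpy_class_in_carrier[OF f])

lemma cls_multiples: "j \<in> {1..r} \<Longrightarrow> cls (\<lambda>x. multiples a x j) = cls f [^]\<^bsub>WG\<^esub> a j"
  by (simp add: multiples_def htpy_class_power[OF f])

lemma pcls_eq_iff:
  assumes "pmap g" "pmap h"
  shows "pcls g = pcls h \<longleftrightarrow> (\<forall>j\<in>{1..r}. cls (\<lambda>x. g x j) = cls (\<lambda>x. h x j))"
proof -
  have "pcls g = pcls h \<longleftrightarrow> pointed_homotopic X x0 (power_space W r) (power_pt w0 r) g h"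
    by (rule htpy_class_eq_iff[OF assms(1)])
  also have "\<dots> \<longleftrightarrow> (\<forall>j\<in>{1..r}. pointed_homotopic X x0 W w0 (\<lambda>x. g x j) (\<lambda>x. h x j))"
    by (intro iffI ballI)
      (rule pointed_homotopic_proj, assumption+, rule pointed_homotopic_power_spaceI[OF x0 assms], blast)
  also have "\<dots> \<longleftrightarrow> (\<forall>j\<in>{1..r}. cls (\<lambda>x. g x j) = cls (\<lambda>x. h x j))"
    by (intro ball_cong refl htpy_class_eq_iff[symmetric] pointed_map_proj[OF assms(1)])
  finally show ?thesis .
qed

lemma pcls_eq_multiples_iff:
  assumes "pmap g"
  shows "pcls g = pcls (multiples a) \<longleftrightarrow> (\<forall>j\<in>{1..r}. cls (\<lambda>x. g x j) = cls f [^]\<^bsub>WG\<^esub> a j)"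
  unfolding pcls_eq_iff[OF assms pmap_multiples]
  by (intro ball_cong refl) (simp only: cls_multiples)

text \<open>Coordinatewise this is the equality criterion for powers of the class of
  \<open>f\<close>; the subgroup is thus identified with \<open>r\<close>-tuples of integers modulo
  the order of \<open>f\<close>.\<close>

lemma pcls_multiples_eq_iff:
  "pcls (multiples a) = pcls (multiples b) \<longleftrightarrow>
     (\<forall>j\<in>{1..r}. int (map_order X x0 W w0 mul f) dvd a j - b j)"
  unfolding pcls_eq_multiples_iff[OF pmap_multiples]
  by (intro ball_cong refl) (simp only: cls_multiples map_order_dvd_iff[OF f] dvd_diff_commute)

lemma mult_multiples:
  "pcls (multiples a) \<otimes>\<^bsub>PG\<^esub> pcls (multiples b) = pcls (multiples (\<lambda>j. a j + b j))"
proof -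
  have "pcls (\<lambda>x. power_mult mul r (multiples a x, multiples b x)) = pcls (multiples (\<lambda>j. a j + b j))"
    by (subst pcls_eq_multiples_iff[OF pointed_map_power_mult[OF pmap_multiples pmap_multiples]])
      (simp add: power_mult_apply mult_htpy_class[symmetric] pointed_map_proj[OF pmap_multiples]
        cls_multiples WG.int_pow_mult[OF cls_f])
  then show ?thesis by (simp add: P.mult_htpy_class pmap_multiples)
qed

lemma multiples_zero: "pcls (multiples (\<lambda>_. 0)) = \<one>\<^bsub>PG\<^esub>"
proof -
  have "pcls (\<lambda>_. power_pt w0 r) = pcls (multiples (\<lambda>_. 0))"
    by (subst pcls_eq_multiples_iff[OF pointed_map_const[OF power_pt_in_topspace]])
      (simp add: power_pt_apply one_htpy_group)
  then show ?thesis by (simp add: one_htpy_group)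
qed

lemma multiples_in_carrier: "pcls (multiples a) \<in> carrier PG"
  by (rule htpy_class_in_carrier[OF pmap_multiples])

lemma multiples_minus: "inv\<^bsub>PG\<^esub> pcls (multiples a) = pcls (multiples (\<lambda>j. - a j))"
  by (rule PG.inv_equality) (simp_all add: mult_multiples multiples_zero multiples_in_carrier)

lemma multiples_nat_power:
  "pcls (multiples a) [^]\<^bsub>PG\<^esub> (n::nat) = pcls (multiples (\<lambda>j. int n * a j))"
  by (induction n) (simp_all add: multiples_zero mult_multiples algebra_simps)

lemma multiples_power:
  "pcls (multiples a) [^]\<^bsub>PG\<^esub> (k::int) = pcls (multiples (\<lambda>j. k * a j))"
  by (simp add: int_pow_def2 multiples_nat_power multiples_minus)

lemma pmap_coord_map:
  assumes "pointed_map X x0 W w0 h"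
  shows "pmap (coord_map w0 r h i)"
  unfolding coord_map_def pointed_map_power_space_iff
  by (intro ballI pointed_map_if assms pointed_map_const[OF w0])

lemma cls_coord_map:
  "j \<in> {1..r} \<Longrightarrow> cls (\<lambda>x. coord_map w0 r h i x j) = (if j = i then cls h else \<one>\<^bsub>WG\<^esub>)"
  by (cases "j = i") (simp_all add: coord_map_def one_htpy_group)

lemma pcls_coord_map:
  "pcls (coord_map w0 r (power_map mul neg w0 k \<circ> f) i) = pcls (multiples (\<lambda>j. if j = i then k else 0))"
proof -
  have "pointed_map X x0 W w0 (power_map mul neg w0 k \<circ> f)"
    using pointed_map_power[OF f] by (simp add: o_def)
  moreover have "cls (power_map mul neg w0 k \<circ> f) = cls f [^]\<^bsub>WG\<^esub> k"
    using htpy_class_power[OF f] by (simp add: o_def)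
  ultimately show ?thesis
    by (auto simp: pcls_eq_multiples_iff[OF pmap_coord_map] cls_coord_map)
qed

lemma pcls_coord_map_f:
  "pcls (coord_map w0 r f i) = pcls (multiples (\<lambda>j. if j = i then 1 else 0))"
  by (auto simp: pcls_eq_multiples_iff[OF pmap_coord_map[OF f]] cls_coord_map cls_f)

text \<open>An arbitrary finite \<open>J\<close> makes induction possible; coefficients outside
  \<open>J\<close> default to 0.\<close>

lemma finprod_coord_map:
  assumes "finite J"
  shows "finprod PG (\<lambda>i. pcls (coord_map w0 r f i) [^]\<^bsub>PG\<^esub> (ks i :: int)) J =
    pcls (multiples (\<lambda>j. if j \<in> J then ks j else 0))"
  using assms
proof (induction J)
  case empty
  then show ?case by (simp add: multiples_zero)
next
  case (insert i J)
  have "(\<lambda>j. ks i * (if j = i then 1 else 0) + (if j \<in> J then ks j else 0)) =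
     (\<lambda>j. if j \<in> insert i J then ks j else 0)"
    using insert.hyps by (auto simp: fun_eq_iff)
  then show ?case
    using insert
    by (simp add: pcls_coord_map_f multiples_power multiples_in_carrier mult_multiples)
qed

text \<open>Classes of tuples of multiples include the generators and are closed under the group
  operations.\<close>

lemma coord_subgroup_multiples:
  assumes "A \<in> coord_subgroup X x0 W w0 mul r f"
  obtains a where "A = pcls (multiples a)"
proof -
  have "\<exists>a. A = pcls (multiples a)"
    using assms unfolding coord_subgroup_def
  proof (induction rule: generate.induct)
    case one
    then show ?case using multiples_zero[symmetric] by blast
  next
    case (incl h)
    then show ?case using pcls_coord_map_f by blast
  next
    case (inv h)
    then obtain i where "h = pcls (multiples (\<lambda>j. if j = i then 1 else 0))"
      using pcls_coord_map_f by blast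
    then show ?case using multiples_minus by blast
  next
    case (eng h1 h2)
    then obtain a1 a2 where "h1 = pcls (multiples a1)" "h2 = pcls (multiples a2)" by blast
    then show ?case using mult_multiples by blast
  qed
  then show ?thesis using that by blast
qed

section \<open>Shears, reduction of tuples and the fibres they define\<close>

text \<open>The shear \<phi> adds coordinate \<open>j\<close> to coordinate \<open>i\<close>, and
  \<psi> subtracts it again. As \<open>i \<noteq> j\<close>, coordinate \<open>j\<close> is
  untouched by both, so they are inverse up to homotopy.\<close>

lemma fibre_shear:
  assumes ij: "i \<in> {1..r}" "j \<in> {1..r}" "i \<noteq> j" and g: "pmap g"
  shows "pointed_homotopy_equivalent
     (fib (\<lambda>x. \<lambda>l\<in>{1..r}. if l = i then mul (g x i, g x j) else g x l)) (x0, const_path (power_pt w0 r))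
     (fib g) (x0, const_path (power_pt w0 r))"
proof -
  let ?P = "power_space W r" and ?p = "power_pt w0 r"
  define \<phi> where "\<phi> y = (\<lambda>l\<in>{1..r}. if l = i then mul (y i, y j) else y l)" for y :: "nat \<Rightarrow> 'w"
  define \<psi> where "\<psi> y = (\<lambda>l\<in>{1..r}. if l = i then mul (y i, neg (y j)) else y l)" for y :: "nat \<Rightarrow> 'w"
  note pt = power_pt_in_topspace
  have idm: "pointed_map ?P ?p ?P ?p (\<lambda>y. y)" by (simp add: pointed_map_def)
  note pr = pointed_map_proj[OF idm]
  have \<phi>: "pointed_map ?P ?p ?P ?p \<phi>"
    unfolding \<phi>_def[abs_def] pointed_map_power_space_iff
    using ij by (intro ballI pointed_map_if pointed_map_mul pr)
  have \<psi>: "pointed_map ?P ?p ?P ?p \<psi>"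
    unfolding \<psi>_def[abs_def] pointed_map_power_space_iff
    using ij by (intro ballI pointed_map_if pointed_map_mul pointed_map_neg pr)
  \<comment> \<open>Coordinate projections are elements of the group of classes of maps from the
    power to \<open>W\<close>; cancellation there yields the homotopies for both composites.\<close>
  let ?G = "htpy_group ?P ?p W w0 mul"
  interpret G: comm_group ?G by (rule comm_group_htpy_group)
  let ?c = "htpy_class ?P ?p W w0"
  have pi: "pointed_map ?P ?p W w0 (\<lambda>y. y i)" and pj: "pointed_map ?P ?p W w0 (\<lambda>y. y j)"
    using pr ij by auto
  note c = htpy_class_in_carrier[OF pi, of mul] htpy_class_in_carrier[OF pj, of mul]
  note pms = pi pj pointed_map_mul pointed_map_neg
  have "?c (\<lambda>y. mul (mul (y i, y j), neg (y j))) = ?c (\<lambda>y. y i)"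
    using c by (simp add: mult_htpy_class[symmetric] inv_htpy_class[symmetric] pms G.m_assoc)
  then have 1: "pointed_homotopic ?P ?p W w0 (\<lambda>y. mul (mul (y i, y j), neg (y j))) (\<lambda>y. y i)"
    by (simp add: htpy_class_eq_iff pms)
  have "?c (\<lambda>y. mul (mul (y i, neg (y j)), y j)) = ?c (\<lambda>y. y i)"
    using c by (simp add: mult_htpy_class[symmetric] inv_htpy_class[symmetric] pms G.m_assoc)
  then have 2: "pointed_homotopic ?P ?p W w0 (\<lambda>y. mul (mul (y i, neg (y j)), y j)) (\<lambda>y. y i)"
    by (simp add: htpy_class_eq_iff pms)
  have "pointed_homotopic ?P ?p ?P ?p (\<lambda>y. \<psi> (\<phi> y)) (\<lambda>y. y)"
  proof (rule pointed_homotopic_power_spaceI[OF pt _ idm])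
    show "pointed_map ?P ?p ?P ?p (\<lambda>y. \<psi> (\<phi> y))"
      using pointed_map_compose[OF \<phi> \<psi>] by (simp add: o_def)
    fix l assume l: "l \<in> {1..r}"
    show "pointed_homotopic ?P ?p W w0 (\<lambda>y. \<psi> (\<phi> y) l) (\<lambda>y. y l)"
      using l ij 1 pointed_homotopic_refl[OF pr[OF l]] by (cases "l = i") (auto simp: \<phi>_def \<psi>_def)
  qed
  then have \<psi>\<phi>: "pointed_homotopic ?P ?p ?P ?p (\<psi> \<circ> \<phi>) id" by (simp add: o_def id_def)
  have "pointed_homotopic ?P ?p ?P ?p (\<lambda>y. \<phi> (\<psi> y)) (\<lambda>y. y)"
  proof (rule pointed_homotopic_power_spaceI[OF pt _ idm])
    show "pointed_map ?P ?p ?P ?p (\<lambda>y. \<phi> (\<psi> y))"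
      using pointed_map_compose[OF \<psi> \<phi>] by (simp add: o_def)
    fix l assume l: "l \<in> {1..r}"
    show "pointed_homotopic ?P ?p W w0 (\<lambda>y. \<phi> (\<psi> y) l) (\<lambda>y. y l)"
      using l ij 2 pointed_homotopic_refl[OF pr[OF l]] by (cases "l = i") (auto simp: \<phi>_def \<psi>_def)
  qed
  then have \<phi>\<psi>: "pointed_homotopic ?P ?p ?P ?p (\<phi> \<circ> \<psi>) id" by (simp add: o_def id_def)
  show ?thesis
    using homotopy_fibre_post_equivalent[OF g x0 \<phi> \<psi> \<psi>\<phi> \<phi>\<psi>] by (simp add: o_def \<phi>_def)
qed

lemma fibre_pcls_eq:
  assumes "pmap g" "pcls g = pcls h"
  shows "pointed_homotopy_equivalent (fib g) (x0, const_path (power_pt w0 r)) (fib h) (x0, const_path (power_pt w0 r))"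
  using assms htpy_class_eq_iff[OF assms(1)]
  by (intro homotopy_fibre_homotopic_equivalent[OF _ x0 power_pt_in_topspace]) blast

text \<open>The shear produces the product of two power maps of \<open>f\<close>, which is only
  homotopic to the power map for the sum of the exponents; invariance of the fibre under homotopy
  closes the gap.\<close>

lemma fibre_multiples_add:
  assumes ij: "i \<in> {1..r}" "j \<in> {1..r}" "i \<noteq> j"
  shows "pointed_homotopy_equivalent
     (fib (multiples a)) (x0, const_path (power_pt w0 r))
     (fib (multiples (a(i := a i + a j)))) (x0, const_path (power_pt w0 r))"
proof -
  let ?h = "\<lambda>x. \<lambda>l\<in>{1..r}. if l = i then mul (multiples a x i, multiples a x j) else multiples a x l"
  note pr = pointed_map_proj[OF pmap_multiples]
  have h: "pmap ?h"
    unfolding pointed_map_power_space_iff using ij by (intro ballI pointed_map_if pointed_map_mul pr)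
  have "pcls ?h = pcls (multiples (a(i := a i + a j)))"
  proof (subst pcls_eq_multiples_iff[OF h], rule ballI)
    fix l assume l: "l \<in> {1..r}"
    show "cls (\<lambda>x. ?h x l) = cls f [^]\<^bsub>WG\<^esub> (a(i := a i + a j)) l"
      using l ij by (cases "l = i")
       (simp_all add: mult_htpy_class[symmetric] pr cls_multiples WG.int_pow_mult[OF cls_f])
  qed
  then show ?thesis
    using pointed_homotopy_equivalent_sym[OF fibre_shear[OF ij pmap_multiples, of a]] fibre_pcls_eq[OF h]
    by (blast intro: pointed_homotopy_equivalent_trans)
qed

lemma fibre_multiples_Gcd:
  assumes r: "r \<ge> 2"
  shows "pointed_homotopy_equivalent
      (fib (multiples a)) (x0, const_path (power_pt w0 r))
      (prod_topology
         (homotopy_fibre X W w0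
           (power_map mul neg w0 (Gcd (insert (int (map_order X x0 W w0 mul f)) (a ` {1..r}))) \<circ> f))
         (product_topology (\<lambda>_. loop_topology W w0) {1..r - 1}))
      ((x0, const_path w0), (\<lambda>i\<in>{1..r - 1}. const_path w0))"
proof -
  let ?k = "Gcd (insert (int (map_order X x0 W w0 mul f)) (a ` {1..r}))"
  let ?b = "\<lambda>j. if j = 1 then ?k else 0"
  let ?E = "\<lambda>a b. pointed_homotopy_equivalent (fib (multiples a)) (x0, const_path (power_pt w0 r))
     (fib (multiples b)) (x0, const_path (power_pt w0 r))"
  have "?E a ?b"
  \<comment> \<open>Tuples congruent modulo the order of \<open>f\<close> have the same class, and
    the additions required of \<open>R\<close> are the shears.\<close>
  proof (rule reduce_Gcd[where R = ?E and m = "int (map_order X x0 W w0 mul f)"])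
    fix a b assume "\<forall>j\<in>{1..r}. int (map_order X x0 W w0 mul f) dvd a j - b j"
    then show "?E a b"
      using fibre_pcls_eq[OF pmap_multiples] pcls_multiples_eq_iff by blast
  qed (use r fibre_multiples_add in \<open>blast intro: pointed_homotopy_equivalent_sym pointed_homotopy_equivalent_trans\<close>)+
  also have "pointed_homotopy_equivalent (fib (multiples ?b)) (x0, const_path (power_pt w0 r))
     (fib (coord_map w0 r (power_map mul neg w0 ?k \<circ> f) 1)) (x0, const_path (power_pt w0 r))"
    by (rule fibre_pcls_eq[OF pmap_multiples pcls_coord_map[symmetric]])
  also have "pointed_homotopy_equivalent
      (fib (coord_map w0 r (power_map mul neg w0 ?k \<circ> f) 1)) (x0, const_path (power_pt w0 r))
      (prod_topology (homotopy_fibre X W w0 (power_map mul neg w0 ?k \<circ> f))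
         (product_topology (\<lambda>_. loop_topology W w0) {1..r - 1}))
      ((x0, const_path w0), (\<lambda>i\<in>{1..r - 1}. const_path w0))"
    using r pointed_map_power[OF f, of ?k] by (intro homotopy_fibre_coord_map x0) (auto simp: o_def)
  finally show ?thesis .
qed

section \<open>Recovering the gcd from the order of a tuple\<close>

lemma map_order_multiples_dvd_iff:
  assumes "pmap g" "pcls g = pcls (multiples a)"
  shows "map_order X x0 (power_space W r) (power_pt w0 r) (power_mult mul r) g dvd n \<longleftrightarrow>
     int (map_order X x0 W w0 mul f) dvd int n * Gcd (insert (int (map_order X x0 W w0 mul f)) (a ` {1..r}))"
proof -
  let ?m = "int (map_order X x0 W w0 mul f)"
  have "map_order X x0 (power_space W r) (power_pt w0 r) (power_mult mul r) g dvd n \<longleftrightarrow>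
      pcls g [^]\<^bsub>PG\<^esub> n = \<one>\<^bsub>PG\<^esub>"
    unfolding map_order_def by (rule PG.pow_eq_id[OF htpy_class_in_carrier[OF assms(1)], symmetric])
  also have "\<dots> \<longleftrightarrow> (\<forall>j\<in>{1..r}. ?m dvd int n * a j)"
    using pcls_multiples_eq_iff[of "\<lambda>j. int n * a j" "\<lambda>_. 0"]
    by (simp add: assms(2) multiples_nat_power multiples_zero)
  \<comment> \<open>Inserting \<open>?m\<close> adds the condition that \<open>?m\<close> divides
    \<open>int n * ?m\<close>, which always holds.\<close>
  also have "\<dots> \<longleftrightarrow> ?m dvd Gcd ((*) (int n) ` insert ?m (a ` {1..r}))"
    by (auto simp: dvd_Gcd_iff)
  also have "Gcd ((*) (int n) ` insert ?m (a ` {1..r})) = int n * Gcd (insert ?m (a ` {1..r}))"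
    by (simp only: Gcd_mult) (simp add: abs_mult)
  finally show ?thesis .
qed

text \<open>Equal orders mean that the same \<open>n\<close> annihilate both tuples. Writing
  \<open>k\<close> and \<open>k'\<close> for the two gcds, positive divisors of \<open>m\<close>,
  the number \<open>m / k\<close> annihilates the first tuple and hence the second; cancelling in
  the resulting divisibility gives that \<open>k\<close> divides \<open>k'\<close>, and
  conversely.\<close>

lemma Gcd_eq_if_map_order_eq:
  assumes g: "pmap g" "pcls g = pcls (multiples a)" and g': "pmap g'" "pcls g' = pcls (multiples a')"
    and "map_order X x0 W w0 mul f > 0"
    and eq: "map_order X x0 (power_space W r) (power_pt w0 r) (power_mult mul r) g =
      map_order X x0 (power_space W r) (power_pt w0 r) (power_mult mul r) g'"
  shows "Gcd (insert (int (map_order X x0 W w0 mul f)) (a ` {1..r})) =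
    Gcd (insert (int (map_order X x0 W w0 mul f)) (a' ` {1..r}))"
proof -
  define m where "m = int (map_order X x0 W w0 mul f)"
  define k where "k b = Gcd (insert m (b ` {1..r}))" for b :: "nat \<Rightarrow> int"
  have m: "m > 0" using assms(5) by (simp add: m_def)
  have dvd: "k b dvd m" and pos: "k b > 0" for b
    using m by (simp_all add: k_def)
  have iff: "m dvd int n * k a \<longleftrightarrow> m dvd int n * k a'" for n
    using map_order_multiples_dvd_iff[OF g, of n] map_order_multiples_dvd_iff[OF g', of n]
    by (simp add: eq m_def k_def)
  \<comment> \<open>take \<open>n = m / k b\<close>\<close>
  have "k b dvd k c" if iff: "\<And>n. m dvd int n * k b \<longleftrightarrow> m dvd int n * k c" for b c
  proof -
    obtain n where n: "m = k b * n" using dvd[of b] by blast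
    then have "n > 0" using m pos[of b] by (simp add: zero_less_mult_iff)
    then have "m dvd int (nat n) * k b" using n by (simp add: mult.commute)
    then have "m dvd n * k c" using iff \<open>n > 0\<close> by (metis int_nat_eq less_imp_le)
    then show ?thesis using n \<open>n > 0\<close> by (simp add: mult.commute)
  qed
  then have "k a dvd k a'" "k a' dvd k a" using iff by blast+
  then show ?thesis
    using pos[of a] pos[of a'] unfolding m_def[symmetric] k_def[symmetric] by (simp add: zdvd_antisym_nonneg)
qed

end

theorem theorem1p2:
  fixes X :: "'a topology" and x0 :: 'a
    and Y :: "'b topology" and y0 :: 'b
    and ZX :: "'c topology" and ZY :: "'d topology"
    and mul :: "'b \<times> 'b \<Rightarrow> 'b" and neg :: "'b \<Rightarrow> 'b"
    and f :: "'a \<Rightarrow> 'b" and r :: nat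
  assumes "CW_complex ZX" and "X homotopy_equivalent_space ZX"
    and "CW_complex ZY" and "Y homotopy_equivalent_space ZY"
    and "nondegenerate_basepoint X x0" and "nondegenerate_basepoint Y y0"
    and "H_group Y y0 mul neg" and "homotopy_commutative Y y0 mul"
    and "pointed_map X x0 Y y0 f"
    and "r \<ge> 2"
  shows
    "(\<forall>(ks :: nat \<Rightarrow> int) (g :: 'a \<Rightarrow> nat \<Rightarrow> 'b) (k :: int).
        pointed_map X x0 (power_space Y r) (power_pt y0 r) g \<longrightarrow>
        power_htpy_class X x0 Y y0 r g =
          finprod (power_htpy_group X x0 Y y0 mul r)
            (\<lambda>i. power_htpy_class X x0 Y y0 r (coord_map y0 r f i)
                   [^]\<^bsub>power_htpy_group X x0 Y y0 mul r\<^esub> ks i) {1..r} \<longrightarrow>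
        k = Gcd (insert (int (map_order X x0 Y y0 mul f)) (ks ` {1..r})) \<longrightarrow>
        pointed_homotopy_equivalent
          (homotopy_fibre X (power_space Y r) (power_pt y0 r) g)
          (x0, const_path (power_pt y0 r))
          (prod_topology
             (homotopy_fibre X Y y0 (power_map mul neg y0 k \<circ> f))
             (product_topology (\<lambda>_. loop_topology Y y0) {1..r - 1}))
          ((x0, const_path y0), (\<lambda>i\<in>{1..r - 1}. const_path y0))) \<and>
     (map_order X x0 Y y0 mul f > 0 \<longrightarrow>
       (\<forall>g g' :: 'a \<Rightarrow> nat \<Rightarrow> 'b.
          pointed_map X x0 (power_space Y r) (power_pt y0 r) g \<longrightarrow>
          pointed_map X x0 (power_space Y r) (power_pt y0 r) g' \<longrightarrow>
          power_htpy_class X x0 Y y0 r g \<in> coord_subgroup X x0 Y y0 mul r f \<longrightarrow>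
          power_htpy_class X x0 Y y0 r g' \<in> coord_subgroup X x0 Y y0 mul r f \<longrightarrow>
          map_order X x0 (power_space Y r) (power_pt y0 r) (power_mult mul r) g =
            map_order X x0 (power_space Y r) (power_pt y0 r) (power_mult mul r) g' \<longrightarrow>
          pointed_homotopy_equivalent
            (homotopy_fibre X (power_space Y r) (power_pt y0 r) g)
            (x0, const_path (power_pt y0 r))
            (homotopy_fibre X (power_space Y r) (power_pt y0 r) g')
            (x0, const_path (power_pt y0 r))))"
proof -
  interpret map_to_abelian_H_group Y y0 mul neg X x0 f r
    using assms by unfold_locales (auto simp: nondegenerate_basepoint_def)
  have split: "pointed_homotopy_equivalent (fib g) (x0, const_path (power_pt y0 r))
      (prod_topology
         (homotopy_fibre X Y y0
           (power_map mul neg y0 (Gcd (insert (int (map_order X x0 Y y0 mul f)) (a ` {1..r}))) \<circ> f))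
         (product_topology (\<lambda>_. loop_topology Y y0) {1..r - 1}))
      ((x0, const_path y0), (\<lambda>i\<in>{1..r - 1}. const_path y0))"
    if "pmap g" "pcls g = pcls (multiples a)" for g a
    by (rule pointed_homotopy_equivalent_trans[OF fibre_pcls_eq[OF that] fibre_multiples_Gcd[OF assms(10)]])
  show ?thesis
  proof (intro conjI allI impI)
    fix ks g k
    assume g: "pmap g" and "pcls g = finprod PG (\<lambda>i. pcls (coord_map y0 r f i) [^]\<^bsub>PG\<^esub> (ks i :: int)) {1..r}"
      and k: "k = Gcd (insert (int (map_order X x0 Y y0 mul f)) (ks ` {1..r}))"
    then have "pcls g = pcls (multiples (\<lambda>j. if j \<in> {1..r} then ks j else 0))"
      by (simp add: finprod_coord_map)
    \<comment> \<open>The two coefficient functions differ only off \<open>{1..r}\<close>.\<close>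
    also have "\<dots> = pcls (multiples ks)"
      by (simp add: pcls_multiples_eq_iff)
    finally show "pointed_homotopy_equivalent (fib g) (x0, const_path (power_pt y0 r))
      (prod_topology (homotopy_fibre X Y y0 (power_map mul neg y0 k \<circ> f))
         (product_topology (\<lambda>_. loop_topology Y y0) {1..r - 1}))
      ((x0, const_path y0), (\<lambda>i\<in>{1..r - 1}. const_path y0))"
      unfolding k by (rule split[OF g])
  next
    fix g g'
    assume m: "map_order X x0 Y y0 mul f > 0" and g: "pmap g" and g': "pmap g'"
      and "pcls g \<in> coord_subgroup X x0 Y y0 mul r f" "pcls g' \<in> coord_subgroup X x0 Y y0 mul r f"
      and eq: "map_order X x0 (power_space Y r) (power_pt y0 r) (power_mult mul r) g =
            map_order X x0 (power_space Y r) (power_pt y0 r) (power_mult mul r) g'"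
    then obtain a a' where a: "pcls g = pcls (multiples a)" and a': "pcls g' = pcls (multiples a')"
      by (metis coord_subgroup_multiples)
    show "pointed_homotopy_equivalent (fib g) (x0, const_path (power_pt y0 r))
      (fib g') (x0, const_path (power_pt y0 r))"
      \<comment> \<open>Since the gcds agree, both fibres are equivalent to literally the same
        product.\<close>
      using pointed_homotopy_equivalent_trans[OF split[OF g a] pointed_homotopy_equivalent_sym[OF split[OF g' a',
          folded Gcd_eq_if_map_order_eq[OF g a g' a' m eq]]]] .
  qed
qed

end
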